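(* For $g\in G=\mathrm{Sp}(4,\mathbb R)$ and parameters in the region of absolute convergence of the respective Eisenstein series, one has $$E_0(g,\nu)=\frac14\sum_{v\in V_0(\mathbb Z)\ \text{primitive}}(v_\beta^\top gg^\top v_\beta)^{\nu_2-\nu_1-1/2}\,\bigl(v_\alpha^\top(g\wedge g)(g\wedge g)^\top v_\alpha\bigr)^{\nu_1/2-\nu_2-1/2}\qquad(\nu=(\nu_1,\nu_2)\in\mathbb C^2),$$ $$E_\alpha(g,\nu,1)=\frac12\sum_{v_\alpha\in V_\alpha(\mathbb Z)\ \text{primitive}}\bigl(v_\alpha^\top(g\wedge g)(g\wedge g)^\top v_\alpha\bigr)^{-\nu/2-3/4}\qquad(\nu\in\mathbb C),$$ $$E_\beta(g,\nu,1)=\frac12\sum_{v_\beta\in V_\beta(\mathbb Z)\ \text{primitive}}(v_\beta^\top gg^\top v_\beta)^{-\nu/2-1}\qquad(\nu\in\mathbb C),$$ where $v_\beta=(v_1,v_2,v_3,v_4)^\top$, $v_\alpha=(v_{12},v_{13},v_{14},v_{23},v_{24},v_{34})^\top$, and $g\wedge g=(g_{ij,kl})_{1\le i<j\le4,\,1\le k<l\le4}$ with $g_{ij,kl}=g_{ik}g_{jl}-g_{il}g_{jk}$ is the exterior square of $g$ (index pairs in the order $12,13,14,23,24,34$).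
   Context: Let $J=\begin{pmatrix}0&I_2\\-I_2&0\end{pmatrix}$, $G=\mathrm{Sp}(4,\mathbb R)=\{g\in\mathrm{GL}(4,\mathbb R): g^\top Jg=J\}$, $\Gamma=\mathrm{Sp}(4,\mathbb Z)$, $K=\left\{\begin{pmatrix}A&B\\-B&A\end{pmatrix}: A+iB\in U(2)\right\}$. Every $g\in G/K$ has a unique (Iwasawa) representative $$\begin{pmatrix}1&n_1&n_2&n_3\\0&1&n_4&n_5\\0&0&1&0\\0&0&-n_1&1\end{pmatrix}\mathrm{diag}(y_1,y_2,y_1^{-1},y_2^{-1}),\quad n_3=n_1n_5+n_4,\ y_1,y_2>0.$$ The standard parabolic subgroups are $$P_0=\begin{pmatrix}*&*&*&*\\0&*&*&*\\0&0&*&0\\0&0&*&*\end{pmatrix}\cap G,\quad P_\alpha=\begin{pmatrix}*&*&*&*\\ *&*&*&*\\0&0&*&*\\0&0&*&*\end{pmatrix}\cap G,\quad P_\beta=\begin{pmatrix}*&*&*&*\\0&*&*&*\\0&0&*&0\\0&*&*&*\end{pmatrix}\cap G .$$ Define $I_0(g,\nu)=y_1^{\nu_1+2}y_2^{2\nu_2-\nu_1+1}$, $I_\alpha(g,\nu)=(y_1y_2)^{\nu+3/2}$, $I_\beta(g,\nu)=y_1^{\nu+2}$, and $$E_0(g,\nu)=\sum_{\gamma\in(P_0\cap\Gamma)\backslash\Gamma}I_0(\gamma g,\nu),\quad E_\alpha(g,\nu,1)=\sum_{\gamma\in(P_\alpha\cap\Gamma)\backslash\Gamma}I_\alpha(\gamma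 g,\nu),\quad E_\beta(g,\nu,1)=\sum_{\gamma\in(P_\beta\cap\Gamma)\backslash\Gamma}I_\beta(\gamma g,\nu).$$ $V_0$ is the set of $v=(v_1,v_2,v_3,v_4;v_{12},v_{13},v_{14},v_{23},v_{24},v_{34})\in\mathbb R^{10}$ with $v_1v_{23}-v_2v_{13}+v_3v_{12}=0$, $v_1v_{24}-v_2v_{14}+v_4v_{12}=0$, $v_1v_{34}-v_3v_{14}+v_4v_{13}=0$, $v_2v_{34}-v_3v_{24}+v_4v_{23}=0$, $v_{13}+v_{24}=0$. $V_\alpha$ is the set of $(v_{12},\dots,v_{34})\in\mathbb R^6$ with $v_{12}v_{34}-v_{24}v_{13}+v_{14}v_{23}=0$ and $v_{13}+v_{24}=0$. $V_\beta=\mathbb R^4$. $V_j(\mathbb Z)$ denotes the integral points. An element of $V_0(\mathbb Z)$ is primitive if $\gcd(v_1,\dots,v_4)=1$ and $\gcd(v_{12},\dots,v_{34})=1$; an element of $V_\alpha(\mathbb Z)$ or $V_\beta(\mathbb Z)$ is primitive if its coordinates have gcd $1$. *)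

theory Defs
  imports "HOL-Analysis.Analysis" "HOL-Algebra.Coset"
begin

section \<open>The symplectic group of rank two\<close>

definition block4 :: "'a^2^2 \<Rightarrow> 'a^2^2 \<Rightarrow> 'a^2^2 \<Rightarrow> 'a^2^2 \<Rightarrow> 'a::zero^4^4" where
  "block4 A B C D = vector
     [vector [A$1$1, A$1$2, B$1$1, B$1$2],
      vector [A$2$1, A$2$2, B$2$1, B$2$2],
      vector [C$1$1, C$1$2, D$1$1, D$1$2],
      vector [C$2$1, C$2$2, D$2$1, D$2$2]]"

definition symplectic_J :: "real^4^4" where
  "symplectic_J = block4 0 (mat 1) (- mat 1) 0"

definition Sp4_real :: "(real^4^4) set" where
  "Sp4_real = {g. invertible g \<and> transpose g ** symplectic_J ** g = symplectic_J}"

definition Sp4_int :: "(real^4^4) set" where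
  "Sp4_int = {g \<in> Sp4_real. \<forall>i j. g$i$j \<in> \<int>}"

definition Sp4_int_group :: "(real^4^4) monoid" where
  "Sp4_int_group = \<lparr>carrier = Sp4_int, monoid.mult = (**), one = mat 1\<rparr>"

definition U2 :: "(complex^2^2) set" where
  "U2 = {u. map_matrix cnj (transpose u) ** u = mat 1}"

definition max_compact :: "(real^4^4) set" where
  "max_compact = {block4 A B (- B) A | A B. (\<chi> i j. Complex (A$i$j) (B$i$j)) \<in> U2}"


section \<open>Iwasawa coordinates\<close>

definition iwasawa_unip :: "real \<Rightarrow> real \<Rightarrow> real \<Rightarrow> real \<Rightarrow> real \<Rightarrow> real^4^4" where
  "iwasawa_unip n1 n2 n3 n4 n5 = vector
     [vector [1, n1, n2, n3],
      vector [0, 1, n4, n5],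
      vector [0, 0, 1, 0],
      vector [0, 0, - n1, 1]]"

definition iwasawa_diag :: "real \<Rightarrow> real \<Rightarrow> real^4^4" where
  "iwasawa_diag y1 y2 = vector
     [vector [y1, 0, 0, 0],
      vector [0, y2, 0, 0],
      vector [0, 0, inverse y1, 0],
      vector [0, 0, 0, inverse y2]]"

definition has_iwasawa_y :: "real^4^4 \<Rightarrow> real \<times> real \<Rightarrow> bool" where
  "has_iwasawa_y g y \<longleftrightarrow> fst y > 0 \<and> snd y > 0 \<and>
     (\<exists>n1 n2 n3 n4 n5. n3 = n1 * n5 + n4 \<and>
        (\<exists>k\<in>max_compact.
           g = iwasawa_unip n1 n2 n3 n4 n5 ** iwasawa_diag (fst y) (snd y) ** k))"

text \<open>On \<^const>\<open>Sp4_real\<close> the pair \<open>(y\<^sub>1, y\<^sub>2)\<close> exists and is unique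
  (Iwasawa decomposition); elsewhere \<open>iwasawa_y\<close> carries no meaning.\<close>

definition iwasawa_y :: "real^4^4 \<Rightarrow> real \<times> real" where
  "iwasawa_y g = (THE y. has_iwasawa_y g y)"

definition I_0 :: "complex \<Rightarrow> complex \<Rightarrow> real^4^4 \<Rightarrow> complex" where
  "I_0 \<nu>1 \<nu>2 g =
     complex_of_real (fst (iwasawa_y g)) powr (\<nu>1 + 2) *
     complex_of_real (snd (iwasawa_y g)) powr (2 * \<nu>2 - \<nu>1 + 1)"

definition I_alpha :: "complex \<Rightarrow> real^4^4 \<Rightarrow> complex" where
  "I_alpha \<nu> g =
     complex_of_real (fst (iwasawa_y g) * snd (iwasawa_y g)) powr (\<nu> + 3/2)"

definition I_beta :: "complex \<Rightarrow> real^4^4 \<Rightarrow> complex" where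
  "I_beta \<nu> g = complex_of_real (fst (iwasawa_y g)) powr (\<nu> + 2)"


section \<open>Standard parabolic subgroups and Eisenstein series\<close>

definition P_0 :: "(real^4^4) set" where
  "P_0 = {g \<in> Sp4_real.
            g$2$1 = 0 \<and>
            g$3$1 = 0 \<and> g$3$2 = 0 \<and> g$3$4 = 0 \<and>
            g$4$1 = 0 \<and> g$4$2 = 0}"

definition P_alpha :: "(real^4^4) set" where
  "P_alpha = {g \<in> Sp4_real.
                g$3$1 = 0 \<and> g$3$2 = 0 \<and>
                g$4$1 = 0 \<and> g$4$2 = 0}"

definition P_beta :: "(real^4^4) set" where
  "P_beta = {g \<in> Sp4_real.
               g$2$1 = 0 \<and>
               g$3$1 = 0 \<and> g$3$2 = 0 \<and> g$3$4 = 0 \<and>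
               g$4$1 = 0}"

text \<open>The set of cosets \<open>(P \<inter> \<Gamma>)\<gamma>\<close> that make up the quotient of \<open>\<Gamma>\<close> by \<open>P \<inter> \<Gamma>\<close> on the left.\<close>

definition parabolic_cosets :: "(real^4^4) set \<Rightarrow> (real^4^4) set set" where
  "parabolic_cosets P = rcosets\<^bsub>Sp4_int_group\<^esub> (P \<inter> Sp4_int)"

text \<open>For the pairs \<open>(P_0, I_0)\<close>, \<open>(P_alpha, I_alpha)\<close>, \<open>(P_beta, I_beta)\<close> the function
  \<open>\<gamma> \<mapsto> I (\<gamma> g)\<close> is constant on each coset, so the representative
  picked below is immaterial.\<close>

definition eisenstein_term ::
    "(real^4^4 \<Rightarrow> complex) \<Rightarrow> real^4^4 \<Rightarrow> (real^4^4) set \<Rightarrow> complex" where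
  "eisenstein_term I g C = I ((SOME \<gamma>. \<gamma> \<in> C) ** g)"

definition eisenstein_abs_conv ::
    "(real^4^4) set \<Rightarrow> (real^4^4 \<Rightarrow> complex) \<Rightarrow> real^4^4 \<Rightarrow> bool" where
  "eisenstein_abs_conv P I g \<longleftrightarrow> (\<lambda>C. norm (eisenstein_term I g C)) summable_on parabolic_cosets P"

definition E_0 :: "real^4^4 \<Rightarrow> complex \<Rightarrow> complex \<Rightarrow> complex" where
  "E_0 g \<nu>1 \<nu>2 = infsum (eisenstein_term (I_0 \<nu>1 \<nu>2) g) (parabolic_cosets P_0)"

definition E_alpha :: "real^4^4 \<Rightarrow> complex \<Rightarrow> complex" where
  "E_alpha g \<nu> = infsum (eisenstein_term (I_alpha \<nu>) g) (parabolic_cosets P_alpha)"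

definition E_beta :: "real^4^4 \<Rightarrow> complex \<Rightarrow> complex" where
  "E_beta g \<nu> = infsum (eisenstein_term (I_beta \<nu>) g) (parabolic_cosets P_beta)"


section \<open>Pluecker-type coordinates\<close>

text \<open>The coordinates \<open>1, ..., 6\<close> of a vector in \<open>real^6\<close> stand for the index pairs
  \<open>12, 13, 14, 23, 24, 34\<close>, in this order. (In the index types, \<open>4 = (0::4)\<close> and
  \<open>6 = (0::6)\<close>.)\<close>

definition index_pair :: "6 \<Rightarrow> 4 \<times> 4" where
  "index_pair p =
     (if p = 1 then (1, 2) else if p = 2 then (1, 3) else if p = 3 then (1, 4)
      else if p = 4 then (2, 3) else if p = 5 then (2, 4) else (3, 4))"

definition ext_square :: "real^4^4 \<Rightarrow> real^6^6" where
  "ext_square g = (\<chi> p q. case (index_pair p, index_pair q) of ((i, j), (k, l)) \<Rightarrow>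
     g$i$k * g$j$l - g$i$l * g$j$k)"

definition V_0 :: "((real^4) \<times> (real^6)) set" where
  "V_0 = {(v, w). let v1 = v$1; v2 = v$2; v3 = v$3; v4 = v$4;
                      v12 = w$1; v13 = w$2; v14 = w$3; v23 = w$4; v24 = w$5; v34 = w$6
     in v1 * v23 - v2 * v13 + v3 * v12 = 0 \<and>
        v1 * v24 - v2 * v14 + v4 * v12 = 0 \<and>
        v1 * v34 - v3 * v14 + v4 * v13 = 0 \<and>
        v2 * v34 - v3 * v24 + v4 * v23 = 0 \<and>
        v13 + v24 = 0}"

definition V_alpha :: "(real^6) set" where
  "V_alpha = {w. let v12 = w$1; v13 = w$2; v14 = w$3; v23 = w$4; v24 = w$5; v34 = w$6
     in v12 * v34 - v24 * v13 + v14 * v23 = 0 \<and> v13 + v24 = 0}"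

definition V_beta :: "(real^4) set" where
  "V_beta = UNIV"

definition real_vec :: "int^'n \<Rightarrow> real^'n" where
  "real_vec v = (\<chi> i. real_of_int (v$i))"

definition primitive_vec :: "int^'n \<Rightarrow> bool" where
  "primitive_vec v \<longleftrightarrow> Gcd (range (\<lambda>i. v$i)) = 1"

text \<open>Primitive integral points, as vectors over \<^typ>\<open>int\<close>.\<close>

definition V_0_prim :: "((int^4) \<times> (int^6)) set" where
  "V_0_prim = {(v, w). (real_vec v, real_vec w) \<in> V_0 \<and> primitive_vec v \<and> primitive_vec w}"

definition V_alpha_prim :: "(int^6) set" where
  "V_alpha_prim = {w. real_vec w \<in> V_alpha \<and> primitive_vec w}"

definition V_beta_prim :: "(int^4) set" where
  "V_beta_prim = {v. real_vec v \<in> V_beta \<and> primitive_vec v}"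

definition gram_form :: "real^'n^'n \<Rightarrow> int^'n \<Rightarrow> real" where
  "gram_form m v = real_vec v \<bullet> ((m ** transpose m) *v real_vec v)"

end

theory Submission
  imports Defs
begin

text \<open>Each summand of an Eisenstein series depends on the representative \<open>\<gamma>\<close> only through its lower
two rows, and even through less. Right multiplication by the maximal compact subgroup is orthogonal,
so in \<open>h = n a k\<close> the third row of \<open>h\<close> has length \<open>1/y\<^sub>1\<close> and the exterior product of its third and
fourth rows has length \<open>1/(y\<^sub>1 y\<^sub>2)\<close>. For \<open>h = \<gamma> g\<close> the squares of these lengths are the values of the
quadratic forms of \<open>g g\<^sup>T\<close> and of \<open>(g \<and> g) (g \<and> g)\<^sup>T\<close> at the third row of \<open>\<gamma>\<close> and at the exterior
product of its lower two rows (\<open>iwasawa_y_translate\<close>), which turns the powers of \<open>y\<^sub>1\<close> and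
\<open>y\<^sub>2\<close> into powers of these values.

Under the right action of \<open>\<Gamma>\<close>, the integral parabolic subgroups are exactly the stabilizers, up to
sign, of \<open>e\<^sub>3\<close>, of \<open>e\<^sub>3 \<and> e\<^sub>4\<close>, or of both (\<open>P_beta_iff\<close>, \<open>P_alpha_iff\<close>, \<open>P_0_eq\<close>). Hence a coset is the same thing
as a vector, a bivector or a pair of both, modulo independent sign changes, that arises from some
element of \<open>\<Gamma>\<close>. It remains to see that what arises is precisely the set of primitive points
(\<open>image_row3\<close>, \<open>image_plane\<close>, \<open>image_flag\<close>). For a primitive vector \<open>v\<close>,
Bezout's identity yields a symplectic \<open>\<int>\<close>-basis whose third member is \<open>v\<close>. For a primitive flag
\<open>(v, w)\<close> this basis is then adjusted. Incidence of \<open>v\<close>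
and \<open>w\<close> makes \<open>w = v \<and> u\<close> with \<open>u\<close> integral, and isotropy kills the coefficient of \<open>u\<close> at the dual
partner of \<open>v\<close>; so, modulo \<open>v\<close>, the vector \<open>u\<close> is an integral combination of the other
two members. Primitivity of \<open>w\<close> makes the coefficients coprime, and a matrix in \<open>SL\<^sub>2(\<int>)\<close> acting on
these two members moves \<open>u\<close> into the last row. For a bivector \<open>w\<close> alone, the Pluecker relation
says that the contractions of \<open>w\<close> with coordinate vectors lie in the plane of \<open>w\<close>, so a primitive
vector incident with \<open>w\<close> exists.

Primitive points are nonzero, so the signs act freely and every coset is counted \<open>2\<close>, \<open>2\<close> or
\<open>4\<close> times in the sum over primitive points (\<open>sum_over_signed_cosets\<close>); this gives the factors
\<open>1/2\<close>, \<open>1/2\<close> and \<open>1/4\<close>.\<close>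


section \<open>Coordinates and the symplectic form\<close>

lemma exhaust_6: fixes x :: 6 shows "x = 1 \<or> x = 2 \<or> x = 3 \<or> x = 4 \<or> x = 5 \<or> x = 6"
proof (induct x)
  case (of_int z)
  then have "z = 0 \<or> z = 1 \<or> z = 2 \<or> z = 3 \<or> z = 4 \<or> z = 5" by auto
  then show ?case by auto
qed

lemma forall_6: "(\<forall>p::6. P p) \<longleftrightarrow> P 1 \<and> P 2 \<and> P 3 \<and> P 4 \<and> P 5 \<and> P 6"
  by (metis exhaust_6)

lemma sum_6: "sum f (UNIV::6 set) = f 1 + f 2 + f 3 + f 4 + f 5 + f 6"
proof -
  have UNIV_6: "(UNIV::6 set) = {1, 2, 3, 4, 5, 6}"
    using exhaust_6 by auto
  show ?thesis
    unfolding UNIV_6 by (simp add: add.assoc)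
qed

lemma vector_4:
  "(vector [a, b, c, d] :: 'a::zero^4)$1 = a"
  "(vector [a, b, c, d] :: 'a::zero^4)$2 = b"
  "(vector [a, b, c, d] :: 'a::zero^4)$3 = c"
  "(vector [a, b, c, d] :: 'a::zero^4)$4 = d"
  unfolding vector_def by simp_all

lemmas index_4_simps = vec_eq_iff forall_4 sum_4 vector_4

lemma matrix_mult_row: "(A ** B)$i = A$i v* B"
  by (simp add: vec_eq_iff matrix_matrix_mult_def vector_matrix_mult_def mult.commute)

lemma vector_matrix_mult_4: "x v* g = x$1 *s g$1 + x$2 *s g$2 + x$3 *s g$3 + x$4 *s g$4"
  for g :: "'a::comm_ring_1^'n^4"
  by (simp add: vec_eq_iff vector_matrix_mult_def sum_4 mult.commute)

definition omega :: "'a::comm_ring_1^4 \<Rightarrow> 'a^4 \<Rightarrow> 'a" where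
  "omega x y = x$1 * y$3 + x$2 * y$4 - x$3 * y$1 - x$4 * y$2"

lemma omega_linear:
  "omega (x + y) z = omega x z + omega y z" "omega z (x + y) = omega z x + omega z y"
  "omega (x - y) z = omega x z - omega y z" "omega z (x - y) = omega z x - omega z y"
  "omega (c *s x) z = c * omega x z" "omega z (c *s x) = c * omega z x"
  by (simp_all add: omega_def algebra_simps)

lemma omega_self [simp]: "omega x x = 0"
  by (simp add: omega_def algebra_simps)

lemma omega_swap: "omega y x = - omega x y"
  by (simp add: omega_def algebra_simps)


section \<open>The symplectic group through the rows of its elements\<close>

text \<open>The defining relations of the symplectic group, written for rows. Stating them over an arbitrary ring
lets the arithmetic of \<open>\<Gamma>\<close> take place over \<open>\<int>\<close>.\<close>

definition symplectic_frame :: "'a::comm_ring_1^4^4 \<Rightarrow> bool" where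
  "symplectic_frame g \<longleftrightarrow>
     omega (g$1) (g$3) = 1 \<and> omega (g$2) (g$4) = 1 \<and> omega (g$1) (g$2) = 0 \<and>
     omega (g$1) (g$4) = 0 \<and> omega (g$2) (g$3) = 0 \<and> omega (g$3) (g$4) = 0"

lemma symplectic_J_eq:
  "symplectic_J = vector [vector [0, 0, 1, 0], vector [0, 0, 0, 1],
                          vector [-1, 0, 0, 0], vector [0, -1, 0, 0]]"
  by (simp add: symplectic_J_def block4_def mat_def)

lemma symplectic_J_mult_J: "symplectic_J ** symplectic_J = - mat 1"
  by (simp add: symplectic_J_eq matrix_matrix_mult_def mat_def index_4_simps)

lemma matrix_mult_uminus:
  fixes A B :: "real^'n^'n"
  shows "(- A) ** B = - (A ** B)" "A ** (- B) = - (A ** B)"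
  by (simp_all add: vec_eq_iff matrix_matrix_mult_def sum_negf)

text \<open>Both equations say that \<open>- J g\<^sup>T J\<close> is an inverse of \<open>g\<close>, on the left and on the right respectively.
The left-hand one is a relation between columns, the right-hand one between rows.\<close>

lemma symplectic_transpose_iff:
  "transpose g ** symplectic_J ** g = symplectic_J \<longleftrightarrow> g ** symplectic_J ** transpose g = symplectic_J"
proof -
  let ?J = symplectic_J and ?h = "- (symplectic_J ** transpose g ** symplectic_J)"
  have cancelJ: "A = B" if "?J ** A = ?J ** B" for A B :: "real^4^4"
  proof -
    have "?J ** (?J ** A) = ?J ** (?J ** B)" using that by simp
    then show ?thesis
      by (simp add: matrix_mul_assoc symplectic_J_mult_J matrix_mult_uminus)
  qed
  have cancelJ': "A = B" if "A ** ?J = B ** ?J" for A B :: "real^4^4"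
  proof -
    have "(A ** ?J) ** ?J = (B ** ?J) ** ?J" using that by simp
    then show ?thesis
      by (simp add: matrix_mul_assoc[symmetric] symplectic_J_mult_J matrix_mult_uminus)
  qed
  have "transpose g ** ?J ** g = ?J \<longleftrightarrow> ?h ** g = mat 1"
    using cancelJ[of "transpose g ** ?J ** g" ?J]
    by (auto simp: matrix_mul_assoc[symmetric] symplectic_J_mult_J matrix_mult_uminus minus_equation_iff)
  also have "\<dots> \<longleftrightarrow> g ** ?h = mat 1"
    by (rule matrix_left_right_inverse)
  also have "\<dots> \<longleftrightarrow> g ** ?J ** transpose g = ?J"
    using cancelJ'[of "g ** ?J ** transpose g" ?J]
    by (auto simp: matrix_mul_assoc symplectic_J_mult_J matrix_mult_uminus minus_equation_iff)
  finally show ?thesis .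
qed

lemma conjugate_J_entry: "(g ** symplectic_J ** transpose g)$i$j = omega (g$i) (g$j)"
  by (simp add: symplectic_J_eq matrix_matrix_mult_def transpose_def sum_4 vector_4 omega_def algebra_simps)

lemma conjugate_J_iff_frame: "g ** symplectic_J ** transpose g = symplectic_J \<longleftrightarrow> symplectic_frame g"
  unfolding vec_eq_iff[of _ symplectic_J] vec_eq_iff conjugate_J_entry
  unfolding forall_4 symplectic_J_eq vector_4 symplectic_frame_def
  by (auto simp: omega_def algebra_simps)

lemma symplectic_inverse:
  assumes "transpose g ** symplectic_J ** g = symplectic_J"
  shows "- (symplectic_J ** transpose g ** symplectic_J) ** g = mat 1"
  using assms by (simp add: matrix_mul_assoc[symmetric] symplectic_J_mult_J matrix_mult_uminus)

lemma Sp4_real_iff_frame: "g \<in> Sp4_real \<longleftrightarrow> symplectic_frame g"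
proof -
  have "invertible g" if "transpose g ** symplectic_J ** g = symplectic_J"
    using symplectic_inverse[OF that] invertible_left_inverse by blast
  then show ?thesis
    unfolding Sp4_real_def conjugate_J_iff_frame[symmetric] symplectic_transpose_iff[symmetric] by blast
qed

lemma Sp4_real_mult:
  assumes "g \<in> Sp4_real" "h \<in> Sp4_real"
  shows "g ** h \<in> Sp4_real"
proof -
  have "transpose (g ** h) ** symplectic_J ** (g ** h)
      = transpose h ** (transpose g ** symplectic_J ** g) ** h"
    by (simp add: matrix_transpose_mul matrix_mul_assoc)
  then show ?thesis
    using assms by (simp add: Sp4_real_def invertible_mult)
qed

lemma Sp4_int_group: "group Sp4_int_group"
proof (rule groupI)
  show "x \<otimes>\<^bsub>Sp4_int_group\<^esub> y \<in> carrier Sp4_int_group"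
    if "x \<in> carrier Sp4_int_group" "y \<in> carrier Sp4_int_group" for x y
    using that Sp4_real_mult by (auto simp: Sp4_int_group_def Sp4_int_def matrix_matrix_mult_def)
  show "\<one>\<^bsub>Sp4_int_group\<^esub> \<in> carrier Sp4_int_group"
    by (simp add: Sp4_int_group_def Sp4_int_def Sp4_real_iff_frame symplectic_frame_def omega_def mat_def)
  show "x \<otimes>\<^bsub>Sp4_int_group\<^esub> y \<otimes>\<^bsub>Sp4_int_group\<^esub> z = x \<otimes>\<^bsub>Sp4_int_group\<^esub> (y \<otimes>\<^bsub>Sp4_int_group\<^esub> z)" for x y z
    by (simp add: Sp4_int_group_def matrix_mul_assoc)
  show "\<one>\<^bsub>Sp4_int_group\<^esub> \<otimes>\<^bsub>Sp4_int_group\<^esub> x = x" for x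
    by (simp add: Sp4_int_group_def)
  show "\<exists>y\<in>carrier Sp4_int_group. y \<otimes>\<^bsub>Sp4_int_group\<^esub> x = \<one>\<^bsub>Sp4_int_group\<^esub>"
    if "x \<in> carrier Sp4_int_group" for x
  proof -
    let ?y = "- (symplectic_J ** transpose x ** symplectic_J)"
    have x: "symplectic_frame x" "transpose x ** symplectic_J ** x = symplectic_J"
      "\<And>i j. x$i$j \<in> \<int>"
      using that by (auto simp: Sp4_int_group_def Sp4_int_def Sp4_real_iff_frame[symmetric] Sp4_real_def)
    have inv: "?y ** x = mat 1"
      using symplectic_inverse[OF x(2)] .
    \<comment> \<open>Written out, the inverse has the entries of \<open>x\<close> up to order and sign; so it is integral.\<close>
    have y: "?y = vector [vector [x$3$3, x$4$3, - x$1$3, - x$2$3], vector [x$3$4, x$4$4, - x$1$4, - x$2$4],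
        vector [- x$3$1, - x$4$1, x$1$1, x$2$1], vector [- x$3$2, - x$4$2, x$1$2, x$2$2]]"
      by (simp add: symplectic_J_eq matrix_matrix_mult_def transpose_def index_4_simps)
    have "x ** symplectic_J ** transpose x = symplectic_J"
      using x(1) by (simp only: conjugate_J_iff_frame)
    then have "?y ** symplectic_J ** transpose ?y = ?y ** (x ** symplectic_J ** transpose x) ** transpose ?y"
      by (simp only:)
    also have "\<dots> = (?y ** x) ** symplectic_J ** transpose (?y ** x)"
      by (simp only: matrix_transpose_mul matrix_mul_assoc)
    finally have "symplectic_frame ?y"
      by (simp only: inv conjugate_J_iff_frame[symmetric] transpose_mat matrix_mul_lid matrix_mul_rid)
    moreover have "\<forall>i j. ?y$i$j \<in> \<int>"
      using x(3) unfolding y by (simp add: forall_4 vector_4)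
    ultimately show ?thesis
      using inv by (auto simp: Sp4_int_group_def Sp4_int_def Sp4_real_iff_frame)
  qed
qed

text \<open>A symplectic basis is dual to itself under the form, up to order and sign; so the coefficients of a
vector are values of the form.\<close>

lemma symplectic_expansion:
  assumes "g \<in> Sp4_real"
  shows "u = omega u (g$3) *s g$1 + omega u (g$4) *s g$2 - omega u (g$1) *s g$3 - omega u (g$2) *s g$4"
proof -
  have col: "g$1$i * g$3$j + g$2$i * g$4$j - g$3$i * g$1$j - g$4$i * g$2$j = symplectic_J$i$j" for i j
    using assms by (auto simp: Sp4_real_def symplectic_J_eq matrix_matrix_mult_def transpose_def
        vec_eq_iff sum_4 vector_4 algebra_simps)
  have "(omega u (g$3) *s g$1 + omega u (g$4) *s g$2 - omega u (g$1) *s g$3 - omega u (g$2) *s g$4)$j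
      = u$1 * symplectic_J$j$3 + u$2 * symplectic_J$j$4 - u$3 * symplectic_J$j$1 - u$4 * symplectic_J$j$2" for j
    unfolding col[symmetric] by (simp add: omega_def algebra_simps)
  then show ?thesis
    by (simp add: vec_eq_iff forall_4 symplectic_J_eq vector_4)
qed


section \<open>Exterior products of rows\<close>

definition wedge :: "'a::comm_ring_1^4 \<Rightarrow> 'a^4 \<Rightarrow> 'a^6" where
  "wedge x y = (\<chi> p. case index_pair p of (i, j) \<Rightarrow> x$i * y$j - x$j * y$i)"

lemma wedge_nth [simp]:
  "wedge x y $ 1 = x$1 * y$2 - x$2 * y$1"
  "wedge x y $ 2 = x$1 * y$3 - x$3 * y$1"
  "wedge x y $ 3 = x$1 * y$4 - x$4 * y$1"
  "wedge x y $ 4 = x$2 * y$3 - x$3 * y$2"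
  "wedge x y $ 5 = x$2 * y$4 - x$4 * y$2"
  "wedge x y $ 6 = x$3 * y$4 - x$4 * y$3"
  by (simp_all add: wedge_def index_pair_def)

lemma wedge_scale: "c *s wedge x y = wedge (c *s x) y"
  by (simp add: vec_eq_iff forall_6 algebra_simps)

text \<open>The exterior square of \<open>g\<close> is the map that \<open>g\<close> induces on bivectors (the Cauchy-Binet identity
for minors of size two).\<close>

lemma wedge_vector_matrix_mult:
  "wedge (x v* g) (y v* g) = wedge x y v* ext_square g"
proof -
  have minor: "(x v* g)$k * (y v* g)$l - (x v* g)$l * (y v* g)$k
      = (\<Sum>p\<in>UNIV. (case index_pair p of (i, j) \<Rightarrow> g$i$k * g$j$l - g$i$l * g$j$k) * wedge x y $ p)" for k l
    by (simp add: vector_matrix_mult_def sum_4 sum_6 index_pair_def algebra_simps)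
  show ?thesis
    unfolding vec_eq_iff
  proof
    fix q
    obtain k l where "index_pair q = (k, l)" by fastforce
    then show "wedge (x v* g) (y v* g) $ q = (wedge x y v* ext_square g) $ q"
      by (simp add: wedge_def[of "x v* g"] minor) (simp add: vector_matrix_mult_def ext_square_def case_prod_beta mult.commute)
  qed
qed

text \<open>Lagrange's identity.\<close>

lemma wedge_inner_self: "wedge x y \<bullet> wedge x y = (x \<bullet> x) * (y \<bullet> y) - (x \<bullet> y)\<^sup>2" for x y :: "real^4"
  by (simp add: inner_vec_def sum_4 sum_6 power2_eq_square algebra_simps)

text \<open>The Gram determinant of the form, expanded into the Pluecker coordinates of \<open>c\<close> and \<open>e\<close>.
When the determinant is \<open>1\<close>, the expansion is a Bezout relation for these coordinates.\<close>

lemma omega_gram: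
  "omega a c * omega b e - omega a e * omega b c =
     (\<Sum>p\<in>UNIV. wedge (vector [- a$3, - a$4, a$1, a$2]) (vector [- b$3, - b$4, b$1, b$2]) $ p * wedge c e $ p)"
  by (simp add: omega_def sum_6 vector_4 algebra_simps)


section \<open>Heights from the lower two rows\<close>

lemma inner_4: "x \<bullet> y = x$1 * y$1 + x$2 * y$2 + x$3 * y$3 + x$4 * y$4" for x y :: "real^4"
  by (simp add: inner_vec_def sum_4)

text \<open>The rows of \<open>A + i B\<close> are orthonormal for the Hermitian product, whose real part is the inner product of
the rows of \<open>k\<close>.\<close>

lemma max_compact_rows:
  assumes "k \<in> max_compact"
  shows "k$3 \<bullet> k$3 = 1" "k$4 \<bullet> k$4 = 1" "k$3 \<bullet> k$4 = 0"
proof -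
  obtain A B where k: "k = block4 A B (- B) A"
    and U: "(\<chi> i j. Complex (A$i$j) (B$i$j)) \<in> U2"
    using assms unfolding max_compact_def by blast
  let ?u = "\<chi> i j. Complex (A$i$j) (B$i$j)"
  have "?u ** map_matrix cnj (transpose ?u) = mat 1"
    using U unfolding U2_def mem_Collect_eq by (rule matrix_left_right_inverse[THEN iffD1])
  then have "Re ((?u ** map_matrix cnj (transpose ?u))$i$j) = Re ((mat 1 :: complex^2^2)$i$j)" for i j
    by simp
  from this[of 1 1] this[of 2 2] this[of 1 2]
  show "k$3 \<bullet> k$3 = 1" "k$4 \<bullet> k$4 = 1" "k$3 \<bullet> k$4 = 0"
    by (simp_all add: k block4_def inner_4 vector_4 matrix_matrix_mult_def sum_2 map_matrix_def
        transpose_def mat_def algebra_simps)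
qed

text \<open>The only matrix of the block form required by the maximal compact subgroup whose lower two rows
are \<open>p\<close> and \<open>q\<close>.\<close>

definition frame_completion :: "real^4 \<Rightarrow> real^4 \<Rightarrow> real^4^4" where
  "frame_completion p q =
     vector [vector [p$3, p$4, - p$1, - p$2], vector [q$3, q$4, - q$1, - q$2], p, q]"

text \<open>The Hermitian product of the complex rows that belong to \<open>p\<close> and \<open>q\<close> has \<open>p \<bullet> q\<close> as its real part and
the symplectic form, up to sign, as its imaginary part.\<close>

lemma frame_completion_max_compact:
  assumes "p \<bullet> p = 1" "q \<bullet> q = 1" "p \<bullet> q = 0" "omega p q = 0"
  shows "frame_completion p q \<in> max_compact"
proof -
  define A B :: "real^2^2"
    where "A = vector [vector [p$3, p$4], vector [q$3, q$4]]"
      and "B = vector [vector [- p$1, - p$2], vector [- q$1, - q$2]]"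
  let ?u = "\<chi> i j. Complex (A$i$j) (B$i$j)"
  have "?u ** map_matrix cnj (transpose ?u) = mat 1"
    using assms
    by (simp add: A_def B_def vec_eq_iff forall_2 matrix_matrix_mult_def sum_2 map_matrix_def
        transpose_def mat_def complex_eq_iff inner_4 omega_def algebra_simps)
  then have "?u \<in> U2"
    unfolding U2_def mem_Collect_eq by (rule matrix_left_right_inverse[THEN iffD1])
  moreover have "frame_completion p q = block4 A B (- B) A"
    by (simp add: frame_completion_def block4_def A_def B_def index_4_simps)
  ultimately show ?thesis
    unfolding max_compact_def by blast
qed

lemma frame_completion_Sp4:
  assumes "p \<bullet> p = 1" "q \<bullet> q = 1" "p \<bullet> q = 0" "omega p q = 0"
  shows "frame_completion p q \<in> Sp4_real"
  using assms
  by (simp add: Sp4_real_iff_frame symplectic_frame_def frame_completion_def vector_4 omega_def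
      inner_4 algebra_simps)

lemma iwasawa_rows:
  assumes "g = iwasawa_unip n1 n2 n3 n4 n5 ** iwasawa_diag y1 y2 ** k"
  shows "g$1 = y1 *s k$1 + (n1 * y2) *s k$2 + (n2 / y1) *s k$3 + (n3 / y2) *s k$4"
    and "g$2 = y2 *s k$2 + (n4 / y1) *s k$3 + (n5 / y2) *s k$4"
    and "g$3 = (1 / y1) *s k$3"
    and "g$4 = (- n1 / y1) *s k$3 + (1 / y2) *s k$4"
proof -
  have na: "iwasawa_unip n1 n2 n3 n4 n5 ** iwasawa_diag y1 y2 =
      vector [vector [y1, n1 * y2, n2 / y1, n3 / y2], vector [0, y2, n4 / y1, n5 / y2],
              vector [0, 0, 1 / y1, 0], vector [0, 0, - n1 / y1, 1 / y2]]"
    by (simp add: index_4_simps matrix_matrix_mult_def iwasawa_unip_def iwasawa_diag_def divide_inverse)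
  show "g$1 = y1 *s k$1 + (n1 * y2) *s k$2 + (n2 / y1) *s k$3 + (n3 / y2) *s k$4"
    "g$2 = y2 *s k$2 + (n4 / y1) *s k$3 + (n5 / y2) *s k$4"
    "g$3 = (1 / y1) *s k$3"
    "g$4 = (- n1 / y1) *s k$3 + (1 / y2) *s k$4"
    unfolding assms matrix_mult_row vector_matrix_mult_4 na vector_4 by simp_all
qed

text \<open>Since the lower rows of \<open>k\<close> are orthonormal, the Gram matrix of the lower rows of \<open>n a k\<close>
depends only on \<open>n a\<close>. Taken from the third row on, its leading minors are \<open>1/y\<^sub>1\<^sup>2\<close> and \<open>1/(y\<^sub>1 y\<^sub>2)\<^sup>2\<close>. In particular \<open>g\<close> determines \<open>y\<^sub>1\<close> and \<open>y\<^sub>2\<close>.\<close>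

lemma has_iwasawa_y_rows:
  assumes "has_iwasawa_y g (y1, y2)"
  shows "y1 > 0" "y2 > 0" "y1\<^sup>2 * (g$3 \<bullet> g$3) = 1"
    "(y1 * y2)\<^sup>2 * (wedge (g$3) (g$4) \<bullet> wedge (g$3) (g$4)) = 1"
proof -
  obtain n1 n2 n3 n4 n5 k where y: "y1 > 0" "y2 > 0" and k: "k \<in> max_compact"
    and g: "g = iwasawa_unip n1 n2 n3 n4 n5 ** iwasawa_diag y1 y2 ** k"
    using assms unfolding has_iwasawa_y_def by auto
  note rows = iwasawa_rows[OF g]
  note k = max_compact_rows[OF k]
  show "y1 > 0" "y2 > 0" by fact+
  have 33: "g$3 \<bullet> g$3 = 1 / y1\<^sup>2"
    using k by (simp add: rows scalar_mult_eq_scaleR power2_eq_square)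
  have 34: "g$3 \<bullet> g$4 = - n1 / y1\<^sup>2"
    using k by (simp add: rows scalar_mult_eq_scaleR power2_eq_square inner_add_right inner_diff_right)
  have 44: "g$4 \<bullet> g$4 = n1\<^sup>2 / y1\<^sup>2 + 1 / y2\<^sup>2"
    using k by (simp add: rows scalar_mult_eq_scaleR power2_eq_square inner_add_left inner_add_right
        inner_diff_left inner_diff_right inner_commute[of "k$4" "k$3"])
  show "y1\<^sup>2 * (g$3 \<bullet> g$3) = 1"
    using y by (simp add: 33)
  show "(y1 * y2)\<^sup>2 * (wedge (g$3) (g$4) \<bullet> wedge (g$3) (g$4)) = 1"
    using y unfolding wedge_inner_self 33 34 44 by (simp add: field_simps power2_eq_square)
qed

lemma has_iwasawa_y_unique:
  assumes "has_iwasawa_y g y" "has_iwasawa_y g z"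
  shows "y = z"
proof -
  obtain y1 y2 z1 z2 where yz: "y = (y1, y2)" "z = (z1, z2)" by fastforce
  note Y = has_iwasawa_y_rows[OF assms(1)[unfolded yz]]
  note Z = has_iwasawa_y_rows[OF assms(2)[unfolded yz]]
  have "y1\<^sup>2 = z1\<^sup>2"
    using Y(3) Z(3) by (metis mult_cancel_right mult_zero_right zero_neq_one)
  then have 1: "y1 = z1"
    using Y(1) Z(1) by simp
  have "(y1 * y2)\<^sup>2 = (z1 * z2)\<^sup>2"
    using Y(4) Z(4) by (metis mult_cancel_right mult_zero_right zero_neq_one)
  then have "y1 * y2 = z1 * z2"
    using Y(1,2) Z(1,2) by simp
  then show ?thesis
    using 1 Y(1) yz by simp
qed

text \<open>Gram-Schmidt on the third and fourth rows gives an orthonormal pair. The span of these rows is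
isotropic, so the pair completes to an element \<open>k\<close> of the maximal compact subgroup. Expanding the upper
rows of \<open>g\<close> in the symplectic basis formed by the rows of \<open>k\<close> yields the remaining entries of \<open>n a\<close>; the
relation between \<open>n\<^sub>3\<close> and the other entries expresses that the first two rows of \<open>g\<close> are orthogonal
for the form.\<close>

lemma iwasawa_exists:
  assumes "g \<in> Sp4_real"
  shows "\<exists>y. has_iwasawa_y g y"
proof -
  have om: "omega (g$1) (g$3) = 1" "omega (g$2) (g$4) = 1" "omega (g$1) (g$2) = 0"
    "omega (g$1) (g$4) = 0" "omega (g$2) (g$3) = 0" "omega (g$3) (g$4) = 0"
    using assms by (auto simp: Sp4_real_iff_frame symplectic_frame_def)
  \<comment> \<open>The Gram-Schmidt coefficient: \<open>r\<close> is the part of the fourth row orthogonal to the third.\<close>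
  define n1 where "n1 = - (g$4 \<bullet> g$3) / (g$3 \<bullet> g$3)"
  define r where "r = g$4 + n1 *s g$3"
  have "g$3 \<noteq> 0"
    using om(1) by (auto simp: omega_def)
  moreover have "omega (g$2) r = 1"
    by (simp add: r_def omega_linear om)
  then have "r \<noteq> 0"
    by (auto simp: omega_def)
  ultimately have pos: "g$3 \<bullet> g$3 > 0" "r \<bullet> r > 0" by simp_all
  define y1 y2 where "y1 = 1 / sqrt (g$3 \<bullet> g$3)" and "y2 = 1 / sqrt (r \<bullet> r)"
  have y: "y1 > 0" "y2 > 0" "y1 * y1 * (g$3 \<bullet> g$3) = 1" "y2 * y2 * (r \<bullet> r) = 1"
    using pos by (simp_all add: y1_def y2_def)
  define p q where "p = y1 *s g$3" and "q = y2 *s r"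
  have pq: "p \<bullet> p = 1" "q \<bullet> q = 1" "p \<bullet> q = 0" "omega p q = 0"
  proof -
    show "p \<bullet> p = 1" "q \<bullet> q = 1"
      using y(3,4) by (simp_all add: p_def q_def scalar_mult_eq_scaleR)
    have "g$3 \<bullet> r = 0"
      using pos(1) by (simp add: r_def n1_def scalar_mult_eq_scaleR inner_add_right inner_diff_right inner_commute)
    then show "p \<bullet> q = 0"
      by (simp add: p_def q_def scalar_mult_eq_scaleR)
    show "omega p q = 0"
      by (simp add: p_def q_def r_def omega_linear om)
  qed
  define k where "k = frame_completion p q"
  have kK: "k \<in> max_compact" and kS: "k \<in> Sp4_real"
    unfolding k_def using pq by (rule frame_completion_max_compact, rule frame_completion_Sp4)
  have k34: "k$3 = p" "k$4 = q"
    by (simp_all add: k_def frame_completion_def vector_4)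
  define n2 n3 n4 n5 where "n2 = - omega (g$1) (k$1) * y1" and "n3 = - omega (g$1) (k$2) * y2"
    and "n4 = - omega (g$2) (k$1) * y1" and "n5 = - omega (g$2) (k$2) * y2"
  have g1: "g$1 = y1 *s k$1 + (n1 * y2) *s k$2 + (n2 / y1) *s k$3 + (n3 / y2) *s k$4"
  proof -
    have "omega (g$1) (k$3) = y1" "omega (g$1) (k$4) = n1 * y2"
      by (simp_all add: k34 p_def q_def r_def omega_linear om)
    then show ?thesis
      using symplectic_expansion[OF kS, of "g$1"] y(1,2)
      by (simp add: n2_def n3_def vec_eq_iff)
  qed
  have g2: "g$2 = y2 *s k$2 + (n4 / y1) *s k$3 + (n5 / y2) *s k$4"
  proof -
    have "omega (g$2) (k$3) = 0" "omega (g$2) (k$4) = y2"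
      by (simp_all add: k34 p_def q_def r_def omega_linear om)
    then show ?thesis
      using symplectic_expansion[OF kS, of "g$2"] y(1,2)
      by (simp add: n4_def n5_def vec_eq_iff)
  qed
  have g3: "g$3 = (1 / y1) *s k$3"
    using y(1) by (simp add: k34 p_def vec_eq_iff)
  have g4: "g$4 = (- n1 / y1) *s k$3 + (1 / y2) *s k$4"
    using y(1,2) by (simp add: k34 p_def q_def r_def vec_eq_iff)
  have "n3 = n1 * n5 + n4"
  proof -
    have kom: "omega (k$1) (k$3) = 1" "omega (k$2) (k$4) = 1" "omega (k$1) (k$2) = 0"
      "omega (k$1) (k$4) = 0" "omega (k$2) (k$3) = 0" "omega (k$3) (k$4) = 0"
      using kS by (auto simp: Sp4_real_iff_frame symplectic_frame_def)
    then have "omega (k$4) (k$2) = -1" "omega (k$3) (k$2) = 0" "omega (k$4) (k$3) = 0"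
      by (simp_all add: omega_swap[of "k$4" "k$2"] omega_swap[of "k$3" "k$2"] omega_swap[of "k$4" "k$3"])
    with kom have "omega (g$1) (g$2) = n4 + n1 * n5 - n3"
      unfolding g1 g2 omega_linear using y(1,2) by simp
    then show ?thesis
      by (simp add: om)
  qed
  moreover have "g = iwasawa_unip n1 n2 n3 n4 n5 ** iwasawa_diag y1 y2 ** k"
    unfolding vec_eq_iff[of g] forall_4
    unfolding iwasawa_rows[OF refl] by (intro conjI g1 g2 g3 g4)
  ultimately have "has_iwasawa_y g (y1, y2)"
    unfolding has_iwasawa_y_def fst_conv snd_conv using y(1,2) kK by blast
  then show ?thesis ..
qed

lemma iwasawa_y_rows:
  assumes "g \<in> Sp4_real"
  defines "y1 \<equiv> fst (iwasawa_y g)" and "y2 \<equiv> snd (iwasawa_y g)"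
  shows "y1 > 0" "y2 > 0" "y1\<^sup>2 * (g$3 \<bullet> g$3) = 1"
    "(y1 * y2)\<^sup>2 * (wedge (g$3) (g$4) \<bullet> wedge (g$3) (g$4)) = 1"
proof -
  have "has_iwasawa_y g (iwasawa_y g)"
    unfolding iwasawa_y_def using iwasawa_exists[OF assms(1)] has_iwasawa_y_unique
    by (metis theI)
  then have "has_iwasawa_y g (y1, y2)"
    by (simp add: y1_def y2_def)
  from has_iwasawa_y_rows[OF this]
  show "y1 > 0" "y2 > 0" "y1\<^sup>2 * (g$3 \<bullet> g$3) = 1"
    "(y1 * y2)\<^sup>2 * (wedge (g$3) (g$4) \<bullet> wedge (g$3) (g$4)) = 1" .
qed


section \<open>Primitive flags are the lower rows of integral symplectic matrices\<close>

lemma real_vec_nth [simp]: "real_vec v $ i = of_int (v$i)"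
  by (simp add: real_vec_def)

lemma real_vec_eq_iff [simp]: "real_vec v = real_vec w \<longleftrightarrow> v = w"
  by (simp add: vec_eq_iff)

lemma omega_real_vec: "omega (real_vec x) (real_vec y) = of_int (omega x y)"
  by (simp add: omega_def)

lemma wedge_real_vec: "wedge (real_vec x) (real_vec y) = real_vec (wedge x y)"
  by (simp add: vec_eq_iff forall_6)

definition real_mat :: "int^'n^'m \<Rightarrow> real^'n^'m" where
  "real_mat M = (\<chi> i. real_vec (M$i))"

text \<open>Inverse to \<open>real_mat\<close> on matrices with integral entries.\<close>

definition int_mat :: "real^'n^'m \<Rightarrow> int^'n^'m" where
  "int_mat g = (\<chi> i j. \<lfloor>g$i$j\<rfloor>)"

lemma real_mat_nth [simp]: "real_mat M $ i = real_vec (M$i)"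
  by (simp add: real_mat_def)

lemma int_mat_real_mat [simp]: "int_mat (real_mat M) = M"
  by (simp add: int_mat_def vec_eq_iff)

lemma symplectic_frame_real_mat: "symplectic_frame (real_mat M) \<longleftrightarrow> symplectic_frame M"
  by (simp add: symplectic_frame_def omega_real_vec)

lemma Sp4_int_eq: "Sp4_int = real_mat ` {M. symplectic_frame M}"
proof (intro equalityI subsetI)
  fix g assume g: "g \<in> Sp4_int"
  have "real_mat (int_mat g) = g"
    using g by (simp add: Sp4_int_def int_mat_def vec_eq_iff)
  moreover from this have "symplectic_frame (int_mat g)"
    using g symplectic_frame_real_mat[of "int_mat g"]
    by (simp add: Sp4_int_def Sp4_real_iff_frame)
  ultimately show "g \<in> real_mat ` {M. symplectic_frame M}"
    by (metis image_eqI mem_Collect_eq)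
next
  fix g assume "g \<in> real_mat ` {M. symplectic_frame M}"
  then show "g \<in> Sp4_int"
    by (auto simp: Sp4_int_def Sp4_real_iff_frame symplectic_frame_real_mat)
qed

lemma symplectic_expansion_int:
  fixes M :: "int^4^4"
  assumes "symplectic_frame M"
  shows "u = omega u (M$3) *s M$1 + omega u (M$4) *s M$2 - omega u (M$1) *s M$3 - omega u (M$2) *s M$4"
    (is "u = ?v")
proof -
  have "real_mat M \<in> Sp4_real"
    using assms by (simp add: Sp4_real_iff_frame symplectic_frame_real_mat)
  from symplectic_expansion[OF this, of "real_vec u"] have "real_vec u = real_vec ?v"
    by (simp add: omega_real_vec vec_eq_iff)
  then show ?thesis
    by simp
qed

lemma primitive_vec_iff: "primitive_vec v \<longleftrightarrow> (\<forall>d. (\<forall>i. d dvd v$i) \<longrightarrow> is_unit d)"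
proof
  assume "primitive_vec v"
  then show "\<forall>d. (\<forall>i. d dvd v$i) \<longrightarrow> is_unit d"
    unfolding primitive_vec_def by (metis Gcd_greatest imageE)
next
  assume *: "\<forall>d. (\<forall>i. d dvd v$i) \<longrightarrow> is_unit d"
  have "is_unit (Gcd (range (\<lambda>i. v$i)))"
    using * by (metis Gcd_dvd rangeI)
  then show "primitive_vec v"
    unfolding primitive_vec_def by (metis Gcd_int_greater_eq_0 zdvd1_eq abs_of_nonneg)
qed

lemma primitive_multiple_exists:
  assumes "v \<noteq> 0"
  shows "\<exists>d v'. d \<noteq> 0 \<and> v = d *s v' \<and> primitive_vec v'"
proof -
  define d where "d = Gcd (range (\<lambda>i. v$i))"
  define v' where "v' = (\<chi> i. v$i div d)"
  have dvd: "d dvd v$i" for i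
    unfolding d_def by (rule Gcd_dvd) simp
  have d0: "d \<noteq> 0"
    using assms by (auto simp: d_def vec_eq_iff)
  have v: "v = d *s v'"
    using dvd by (simp add: v'_def vec_eq_iff)
  have "is_unit e" if "\<forall>i. e dvd v'$i" for e
  proof -
    have "d * e dvd v$i" for i
      using that v by simp
    then have "d * e dvd Gcd (range (\<lambda>i. v$i))"
      by (intro Gcd_greatest) auto
    then have "d * e dvd d"
      by (simp only: d_def)
    then show ?thesis
      using d0 dvd_mult_cancel_left[of d e 1] by simp
  qed
  then show ?thesis
    using d0 v primitive_vec_iff by blast
qed

text \<open>The point is that the cofactors can be taken coprime even when \<open>a = c = 0\<close>, where \<open>d = 0\<close>.\<close>

lemma coprime_split:
  fixes a c :: int
  shows "\<exists>d a' c' x y. a = d * a' \<and> c = d * c' \<and> x * a' + y * c' = 1"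
proof (cases "a = 0 \<and> c = 0")
  case True
  then have "a = 0 * 1 \<and> c = 0 * 0 \<and> 1 * 1 + 0 * 0 = (1::int)" by simp
  then show ?thesis by blast
next
  case False
  let ?d = "gcd a c"
  obtain x y where "x * a + y * c = ?d"
    using bezout_int by blast
  then have "?d * (x * (a div ?d) + y * (c div ?d)) = ?d * 1"
    by (simp add: distrib_left mult.left_commute[of ?d])
  then have "x * (a div ?d) + y * (c div ?d) = 1"
    using False by simp
  then show ?thesis
    by (metis dvd_mult_div_cancel gcd_dvd1 gcd_dvd2)
qed

text \<open>Splitting off the greatest common divisors \<open>p\<close> and \<open>q\<close> of the two pairs of conjugate coordinates
writes \<open>v = p m\<^sub>3 + q m\<^sub>4\<close> with \<open>m\<^sub>3, m\<^sub>4\<close> part of a basis that comes from \<open>SL\<^sub>2(\<int>) \<times> SL\<^sub>2(\<int>)\<close>. Then \<open>p\<close> and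
\<open>q\<close> are coprime, and an element of the Levi subgroup \<open>GL\<^sub>2(\<int>)\<close> moves \<open>(p, q)\<close> to \<open>(1, 0)\<close>.\<close>

lemma symplectic_frame_row3_exists:
  fixes v :: "int^4"
  assumes "primitive_vec v"
  shows "\<exists>M. symplectic_frame M \<and> M$3 = v"
proof -
  obtain p a c x y where p: "v$1 = p * a" "v$3 = p * c" "x * a + y * c = 1"
    using coprime_split by blast
  obtain q b d z t where q: "v$2 = q * b" "v$4 = q * d" "z * b + t * d = 1"
    using coprime_split by blast
  obtain e p' q' s r where e: "p = e * p'" "q = e * q'" "s * p' + r * q' = 1"
    using coprime_split by blast
  have "is_unit e"
    using assms p q e(1,2) unfolding primitive_vec_iff forall_4 by (metis dvd_triv_left dvd_mult2)
  then have "(e * s) * p + (e * r) * q = 1"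
    using e by (auto simp: abs_if split: if_splits)
  \<comment> \<open>The unit \<open>e\<close> is its own inverse, so it can be absorbed into the Bezout coefficients.\<close>
  then obtain s r where pq: "s * p + r * q = 1" by blast
  \<comment> \<open>The pairs \<open>m1, m3\<close> and \<open>m2, m4\<close> span the two coordinate hyperbolic planes.\<close>
  define m1 m2 m3 m4 :: "int^4" where "m1 = vector [y, 0, - x, 0]" and "m2 = vector [0, t, 0, - z]"
    and "m3 = vector [a, 0, c, 0]" and "m4 = vector [0, b, 0, d]"
  have m: "omega m1 m3 = 1" "omega m2 m4 = 1" "omega m1 m2 = 0" "omega m1 m4 = 0" "omega m2 m3 = 0"
    "omega m3 m4 = 0" "omega m2 m1 = 0" "omega m4 m3 = 0"
    using p(3) q(3) by (simp_all add: omega_def m1_def m2_def m3_def m4_def vector_4 algebra_simps)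
  define M :: "int^4^4" where
    "M = vector [s *s m1 + r *s m2, - q *s m1 + p *s m2, p *s m3 + q *s m4, - r *s m3 + s *s m4]"
  have "symplectic_frame M"
    unfolding symplectic_frame_def M_def vector_4 omega_linear omega_self m
    using pq by (simp add: algebra_simps)
  moreover have "M$3 = v"
    using p q by (simp add: M_def vector_4 m3_def m4_def vec_eq_iff forall_4)
  ultimately show ?thesis by blast
qed

text \<open>The vanishing of the trivector \<open>v \<and> w\<close>.\<close>

definition incident :: "int^4 \<Rightarrow> int^6 \<Rightarrow> bool" where
  "incident v w \<longleftrightarrow>
     v$1 * w$4 - v$2 * w$2 + v$3 * w$1 = 0 \<and> v$1 * w$5 - v$2 * w$3 + v$4 * w$1 = 0 \<and>
     v$1 * w$6 - v$3 * w$3 + v$4 * w$2 = 0 \<and> v$2 * w$6 - v$3 * w$5 + v$4 * w$4 = 0"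

lemma V_0_prim_iff:
  "(v, w) \<in> V_0_prim \<longleftrightarrow> incident v w \<and> w$2 + w$5 = 0 \<and> primitive_vec v \<and> primitive_vec w"
proof -
  have "(real_vec v, real_vec w) \<in> V_0 \<longleftrightarrow> incident v w \<and> w$2 + w$5 = 0"
    by (simp add: V_0_def incident_def Let_def flip: of_int_mult of_int_diff of_int_add)
  then show ?thesis
    by (simp add: V_0_prim_def)
qed

lemma V_alpha_prim_iff:
  "w \<in> V_alpha_prim \<longleftrightarrow>
     w$1 * w$6 - w$5 * w$2 + w$3 * w$4 = 0 \<and> w$2 + w$5 = 0 \<and> primitive_vec w"
  by (simp add: V_alpha_prim_def V_alpha_def Let_def flip: of_int_mult of_int_diff of_int_add)

lemma V_beta_prim_iff: "v \<in> V_beta_prim \<longleftrightarrow> primitive_vec v"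
  by (simp add: V_beta_prim_def V_beta_def)

text \<open>Contract \<open>v \<and> w = 0\<close> with the functional \<open>omega r\<close>, which is \<open>1\<close> at \<open>v\<close>: the result is \<open>w = v \<and> u\<close>, where
\<open>u\<close> is the contraction of \<open>w\<close>. No denominators occur, so \<open>u\<close> is integral.\<close>

lemma incident_factor:
  fixes r v :: "int^4" and w :: "int^6"
  assumes "incident v w" "omega r v = 1"
  defines "u \<equiv> vector [r$4 * w$1 - r$1 * w$2 - r$2 * w$3, - r$3 * w$1 - r$1 * w$4 - r$2 * w$5,
      - r$3 * w$2 - r$4 * w$4 - r$2 * w$6, - r$3 * w$3 - r$4 * w$5 + r$1 * w$6] :: int^4"
  shows "w = wedge v u"
proof -
  have inc: "v$1 * w$4 - v$2 * w$2 + v$3 * w$1 = 0" "v$1 * w$5 - v$2 * w$3 + v$4 * w$1 = 0"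
     "v$1 * w$6 - v$3 * w$3 + v$4 * w$2 = 0" "v$2 * w$6 - v$3 * w$5 + v$4 * w$4 = 0"
    and r: "r$1 * v$3 + r$2 * v$4 - r$3 * v$1 - r$4 * v$2 = 1"
    using assms(1,2) by (auto simp: incident_def omega_def)
  show ?thesis
    unfolding vec_eq_iff forall_6 wedge_nth u_def vector_4
    using inc r by (intro conjI) algebra+
qed

text \<open>Complete \<open>v\<close> to a symplectic basis \<open>N\<close> and write \<open>w = v \<and> u\<close>. Isotropy of \<open>w\<close> removes the first
basis vector from \<open>u\<close>, and the multiple of \<open>v\<close> in \<open>u\<close> does not contribute to \<open>w\<close>; what remains is a
combination of \<open>N\<^sub>2\<close> and \<open>N\<^sub>4\<close> with coprime coefficients. A change of this hyperbolic pair by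
\<open>SL\<^sub>2(\<int>)\<close> turns the combination into the fourth basis vector.\<close>

lemma symplectic_flag_exists:
  assumes "(v, w) \<in> V_0_prim"
  shows "\<exists>M. symplectic_frame M \<and> M$3 = v \<and> wedge (M$3) (M$4) = w"
proof -
  have vw: "incident v w" "w$2 + w$5 = 0" "primitive_vec v" "primitive_vec w"
    using assms by (simp_all add: V_0_prim_iff)
  obtain N where N: "symplectic_frame N" and N3: "N$3 = v"
    using symplectic_frame_row3_exists[OF vw(3)] by blast
  have om: "omega (N$1) (N$3) = 1" "omega (N$2) (N$4) = 1" "omega (N$1) (N$2) = 0"
    "omega (N$1) (N$4) = 0" "omega (N$2) (N$3) = 0" "omega (N$3) (N$4) = 0"
    using N by (simp_all add: symplectic_frame_def)
  obtain u where w: "w = wedge v u"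
    using incident_factor vw(1) om(1) N3 by blast
  \<comment> \<open>The form on \<open>v, u\<close> is \<open>w\<^sub>1\<^sub>3 + w\<^sub>2\<^sub>4\<close>.\<close>
  have "omega u v = 0"
    using vw(2) w by (simp add: omega_def algebra_simps)
  then have u: "u = omega u (N$4) *s N$2 - omega u (N$1) *s v - omega u (N$2) *s N$4"
    using symplectic_expansion_int[OF N, of u] N3 by simp
  define b c where "b = omega u (N$4)" and "c = - omega u (N$2)"
  have wbc: "w = b *s wedge v (N$2) + c *s wedge v (N$4)"
    unfolding w by (subst u) (simp add: b_def c_def vec_eq_iff forall_6 algebra_simps)
  obtain e b' c' x y where e: "b = e * b'" "c = e * c'" "x * b' + y * c' = 1"
    using coprime_split by blast
  have "is_unit e"
    using vw(4) wbc e(1,2) unfolding primitive_vec_iff by simp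
  then have "(e * x) * b + (e * y) * c = 1"
    using e by (auto simp: abs_if split: if_splits)
  \<comment> \<open>Again the unit \<open>e\<close> is absorbed into the Bezout coefficients.\<close>
  then obtain x y where xy: "x * b + y * c = 1" by blast
  define M :: "int^4^4" where
    "M = vector [N$1, y *s N$2 - x *s N$4, N$3, b *s N$2 + c *s N$4]"
  have om': "omega (N$4) (N$2) = -1" "omega (N$4) (N$3) = 0" "omega (N$3) (N$2) = 0"
    using om by (simp_all add: omega_swap[of "N$4" "N$2"] omega_swap[of "N$4" "N$3"] omega_swap[of "N$3" "N$2"])
  have "symplectic_frame M"
    unfolding symplectic_frame_def M_def vector_4 omega_linear omega_self om om'
    using xy by (simp add: algebra_simps)
  moreover have "wedge (M$3) (M$4) = w"
    unfolding wbc M_def vector_4 N3 by (simp add: vec_eq_iff forall_6 algebra_simps)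
  ultimately show ?thesis
    using N3 by (auto simp: M_def vector_4)
qed

text \<open>The rows of the skew-symmetric matrix with entries \<open>w\<^sub>i\<^sub>j\<close> are incident with \<open>w\<close> by the Pluecker
relation. One of them is nonzero; dividing it by its content makes it primitive.\<close>

lemma V_alpha_prim_incident_exists:
  assumes "w \<in> V_alpha_prim"
  shows "\<exists>v. (v, w) \<in> V_0_prim"
proof -
  have w: "w$1 * w$6 - w$5 * w$2 + w$3 * w$4 = 0" "w$2 + w$5 = 0" "primitive_vec w"
    using assms by (simp_all add: V_alpha_prim_iff)
  have "w \<noteq> 0"
    using w(3) unfolding primitive_vec_iff by (auto dest: spec[of _ 0])
  have inc: "incident (vector [0, w$1, w$2, w$3]) w" "incident (vector [- w$1, 0, w$4, w$5]) w"
    "incident (vector [- w$2, - w$4, 0, w$6]) w" "incident (vector [- w$3, - w$5, - w$6, 0]) w"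
    using w(1) by (simp_all add: incident_def vector_4 algebra_simps)
  have "\<exists>v. v \<noteq> 0 \<and> incident v w"
  proof (rule ccontr)
    assume "\<not> ?thesis"
    then have "vector [0, w$1, w$2, w$3] = (0 :: int^4)" "vector [- w$1, 0, w$4, w$5] = (0 :: int^4)"
       "vector [- w$2, - w$4, 0, w$6] = (0 :: int^4)"
      using inc by blast+
    then have "w = 0"
      by (simp add: vec_eq_iff forall_4 forall_6 vector_4)
    with \<open>w \<noteq> 0\<close> show False by simp
  qed
  then obtain v0 where "v0 \<noteq> 0" "incident v0 w" by blast
  obtain d v where v: "d \<noteq> 0" "v0 = d *s v" "primitive_vec v"
    using primitive_multiple_exists[OF \<open>v0 \<noteq> 0\<close>] by blast
  have "d * (v$1 * w$4 - v$2 * w$2 + v$3 * w$1) = 0" "d * (v$1 * w$5 - v$2 * w$3 + v$4 * w$1) = 0"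
     "d * (v$1 * w$6 - v$3 * w$3 + v$4 * w$2) = 0" "d * (v$2 * w$6 - v$3 * w$5 + v$4 * w$4) = 0"
    using \<open>incident v0 w\<close> unfolding incident_def v(2) by (simp_all add: algebra_simps)
  then have "incident v w"
    using v(1) unfolding incident_def by simp
  then show ?thesis
    using v(3) w(2,3) V_0_prim_iff by blast
qed

text \<open>Primitivity is witnessed by the pairing with the upper rows: the form gives a Bezout relation for the third
row, its Gram determinant one for the exterior product.\<close>

lemma symplectic_flag_V_0_prim:
  assumes "symplectic_frame M"
  shows "(M$3, wedge (M$3) (M$4)) \<in> V_0_prim"
proof -
  have om: "omega (M$1) (M$3) = 1" "omega (M$2) (M$4) = 1" "omega (M$1) (M$4) = 0" "omega (M$2) (M$3) = 0"
    "omega (M$3) (M$4) = 0"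
    using assms by (simp_all add: symplectic_frame_def)
  have "incident (M$3) (wedge (M$3) (M$4))"
    by (simp add: incident_def algebra_simps)
  moreover have "wedge (M$3) (M$4) $ 2 + wedge (M$3) (M$4) $ 5 = 0"
    using om(5) by (simp add: omega_def algebra_simps)
  moreover have "primitive_vec (M$3)"
    unfolding primitive_vec_iff
  proof (intro allI impI)
    fix d assume "\<forall>i. d dvd M$3$i"
    then have "d dvd omega (M$1) (M$3)"
      by (simp add: omega_def)
    then show "is_unit d" by (simp add: om)
  qed
  moreover have "primitive_vec (wedge (M$3) (M$4))"
    unfolding primitive_vec_iff
  proof (intro allI impI)
    fix d assume "\<forall>p. d dvd wedge (M$3) (M$4) $ p"
    then have "d dvd omega (M$1) (M$3) * omega (M$2) (M$4) - omega (M$1) (M$4) * omega (M$2) (M$3)"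
      unfolding omega_gram by (intro dvd_sum) (simp del: wedge_nth)
    then show "is_unit d" by (simp add: om)
  qed
  ultimately show ?thesis
    by (simp only: V_0_prim_iff)
qed

lemma symplectic_flag_V_alpha_prim:
  assumes "symplectic_frame M"
  shows "wedge (M$3) (M$4) \<in> V_alpha_prim"
  using symplectic_flag_V_0_prim[OF assms]
  unfolding V_0_prim_iff V_alpha_prim_iff by (simp add: algebra_simps)


section \<open>Parabolic subgroups as stabilizers up to sign\<close>

lemma int_mat_Sp4_int:
  assumes "\<gamma> \<in> Sp4_int"
  shows "symplectic_frame (int_mat \<gamma>)" "real_vec (int_mat \<gamma> $ i) = \<gamma>$i"
  using assms by (auto simp: Sp4_int_eq)

lemma real_vec_wedge_int_mat:
  assumes "\<gamma> \<in> Sp4_int"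
  shows "real_vec (wedge (int_mat \<gamma> $ 3) (int_mat \<gamma> $ 4)) = wedge (\<gamma>$3) (\<gamma>$4)"
  by (simp add: wedge_real_vec[symmetric] int_mat_Sp4_int[OF assms])

lemma row_axis: "\<delta>$i = axis i 1 v* \<delta>" for \<delta> :: "real^4^4"
  using exhaust_4[of i] by (auto simp: vec_eq_iff vector_matrix_mult_def sum_4 axis_def)

text \<open>Right multiplication by \<open>\<delta>\<close> is injective on rows and sends a basis vector to a row of \<open>\<delta>\<close>; so
whether \<open>\<eta>\<close> preserves the row of \<open>\<delta>\<close> up to the factor \<open>c\<close> can be read off \<open>\<eta>\<close> alone.\<close>

lemma row_mult_eq_iff:
  fixes \<eta> \<delta> :: "real^4^4"
  assumes "invertible \<delta>"
  shows "(\<eta> ** \<delta>)$i = c *s \<delta>$i \<longleftrightarrow> \<eta>$i = c *s axis i 1"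
proof -
  obtain \<delta>' where \<delta>': "\<delta> ** \<delta>' = mat 1"
    using assms invertible_right_inverse by blast
  have cancel: "(x v* \<delta>) v* \<delta>' = x" for x
    by (simp add: vector_matrix_mul_assoc \<delta>')
  have "(\<eta> ** \<delta>)$i = c *s \<delta>$i \<longleftrightarrow> \<eta>$i v* \<delta> = (c *s axis i 1) v* \<delta>"
    by (simp add: matrix_mult_row row_axis[of \<delta> i] scalar_vector_matrix_assoc)
  also have "\<dots> \<longleftrightarrow> \<eta>$i = c *s axis i 1"
    by (metis cancel)
  finally show ?thesis .
qed

text \<open>The same for bivectors. All bivectors involved are decomposable, so an inverse of \<open>\<delta>\<close> cancels \<open>\<delta>\<close> in
their factors.\<close>

lemma wedge_mult_eq_iff:
  fixes \<eta> \<delta> :: "real^4^4"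
  assumes "invertible \<delta>"
  shows "wedge ((\<eta> ** \<delta>)$i) ((\<eta> ** \<delta>)$j) = c *s wedge (\<delta>$i) (\<delta>$j)
    \<longleftrightarrow> wedge (\<eta>$i) (\<eta>$j) = c *s wedge (axis i 1) (axis j 1)"
proof -
  obtain \<delta>' where \<delta>': "\<delta> ** \<delta>' = mat 1"
    using assms invertible_right_inverse by blast
  have cancel: "wedge (x v* \<delta>) (y v* \<delta>) v* ext_square \<delta>' = wedge x y" for x y
    unfolding wedge_vector_matrix_mult[symmetric] by (simp add: vector_matrix_mul_assoc \<delta>')
  have "c *s wedge (\<delta>$i) (\<delta>$j) = wedge ((c *s axis i 1) v* \<delta>) (axis j 1 v* \<delta>)"
    by (simp add: wedge_scale row_axis[of \<delta> i] row_axis[of \<delta> j] scalar_vector_matrix_assoc)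
  then have "wedge ((\<eta> ** \<delta>)$i) ((\<eta> ** \<delta>)$j) = c *s wedge (\<delta>$i) (\<delta>$j)
    \<longleftrightarrow> wedge (\<eta>$i v* \<delta>) (\<eta>$j v* \<delta>) = wedge ((c *s axis i 1) v* \<delta>) (axis j 1 v* \<delta>)"
    by (simp add: matrix_mult_row)
  also have "\<dots> \<longleftrightarrow> wedge (\<eta>$i) (\<eta>$j) = wedge (c *s axis i 1) (axis j 1)"
    by (metis cancel wedge_vector_matrix_mult)
  finally show ?thesis
    by (simp only: wedge_scale)
qed

text \<open>If the third row is a multiple of the basis vector, the symplectic relations of this row with the others force
the remaining zeros. The multiple is a unit of \<open>\<int>\<close> because its product with the entry at \<open>(1,1)\<close> is \<open>1\<close>.\<close>

lemma P_beta_iff: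
  assumes "\<eta> \<in> Sp4_int"
  shows "\<eta> \<in> P_beta \<longleftrightarrow> (\<exists>e\<in>{1, -1 :: int}. \<eta>$3 = of_int e *s axis 3 1)"
proof -
  obtain M where M: "symplectic_frame M" and \<eta>: "\<eta> = real_mat M"
    using assms by (auto simp: Sp4_int_eq)
  have om: "omega (M$1) (M$3) = 1" "omega (M$2) (M$3) = 0" "omega (M$3) (M$4) = 0"
    using M by (simp_all add: symplectic_frame_def)
  have "\<eta> \<in> Sp4_real"
    using assms by (simp add: Sp4_int_def)
  then have "\<eta> \<in> P_beta \<longleftrightarrow> M$2$1 = 0 \<and> M$3$1 = 0 \<and> M$3$2 = 0 \<and> M$3$4 = 0 \<and> M$4$1 = 0"
    by (simp add: P_beta_def \<eta>)
  also have "\<dots> \<longleftrightarrow> M$3$1 = 0 \<and> M$3$2 = 0 \<and> M$3$4 = 0 \<and> (M$3$3 = 1 \<or> M$3$3 = -1)"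
    using om by (auto simp: omega_def zmult_eq_1_iff)
  also have "\<dots> \<longleftrightarrow> (\<exists>e\<in>{1, -1 :: int}. \<eta>$3 = of_int e *s axis 3 1)"
    by (auto simp: \<eta> vec_eq_iff forall_4 axis_def)
  finally show ?thesis .
qed

lemma wedge_axis_3_4: "wedge (axis 3 1) (axis 4 1) = (axis 6 1 :: real^6)"
  by (simp add: vec_eq_iff forall_6 axis_def)

text \<open>A plane with Pluecker vector \<open>\<plusminus>e\<^sub>3 \<and> e\<^sub>4\<close> is the coordinate plane, so the lower left block vanishes.
Conversely, a vanishing block leaves only the last minor, which divides the Gram determinant \<open>1\<close>.\<close>

lemma P_alpha_iff:
  assumes "\<eta> \<in> Sp4_int"
  shows "\<eta> \<in> P_alpha \<longleftrightarrow> (\<exists>e\<in>{1, -1 :: int}. wedge (\<eta>$3) (\<eta>$4) = of_int e *s wedge (axis 3 1) (axis 4 1))"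
proof -
  obtain M where M: "symplectic_frame M" and \<eta>: "\<eta> = real_mat M"
    using assms by (auto simp: Sp4_int_eq)
  define w where "w = wedge (M$3) (M$4)"
  have gram: "(\<Sum>p\<in>UNIV. wedge (vector [- M$1$3, - M$1$4, M$1$1, M$1$2])
        (vector [- M$2$3, - M$2$4, M$2$1, M$2$2]) $ p * w $ p) = 1"
    using M unfolding w_def omega_gram[symmetric] by (simp add: symplectic_frame_def)
  have "\<eta> \<in> Sp4_real"
    using assms by (simp add: Sp4_int_def)
  then have "\<eta> \<in> P_alpha \<longleftrightarrow> M$3$1 = 0 \<and> M$3$2 = 0 \<and> M$4$1 = 0 \<and> M$4$2 = 0"
    by (simp add: P_alpha_def \<eta>)
  also have "\<dots> \<longleftrightarrow> w$1 = 0 \<and> w$2 = 0 \<and> w$3 = 0 \<and> w$4 = 0 \<and> w$5 = 0 \<and> (w$6 = 1 \<or> w$6 = -1)"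
  proof
    assume *: "M$3$1 = 0 \<and> M$3$2 = 0 \<and> M$4$1 = 0 \<and> M$4$2 = 0"
    then have 0: "w$1 = 0" "w$2 = 0" "w$3 = 0" "w$4 = 0" "w$5 = 0"
      by (simp_all add: w_def)
    then show "w$1 = 0 \<and> w$2 = 0 \<and> w$3 = 0 \<and> w$4 = 0 \<and> w$5 = 0 \<and> (w$6 = 1 \<or> w$6 = -1)"
      using gram unfolding sum_6 by (auto simp: zmult_eq_1_iff)
  next
    assume *: "w$1 = 0 \<and> w$2 = 0 \<and> w$3 = 0 \<and> w$4 = 0 \<and> w$5 = 0 \<and> (w$6 = 1 \<or> w$6 = -1)"
    \<comment> \<open>Each of the lower rows is incident with their exterior product.\<close>
    have "x$1 * w$6 = x$3 * w$3 - x$4 * w$2" "x$2 * w$6 = x$3 * w$5 - x$4 * w$4"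
      if "x = M$3 \<or> x = M$4" for x
      using that by (auto simp: w_def algebra_simps)
    with * have "x$1 * w$6 = 0" "x$2 * w$6 = 0" if "x = M$3 \<or> x = M$4" for x
      using that by auto
    then show "M$3$1 = 0 \<and> M$3$2 = 0 \<and> M$4$1 = 0 \<and> M$4$2 = 0"
      using * by auto
  qed
  also have "\<dots> \<longleftrightarrow> (\<exists>e\<in>{1, -1 :: int}. real_vec w = of_int e *s axis 6 1)"
    by (auto simp: vec_eq_iff forall_6 axis_def)
  finally show ?thesis
    unfolding wedge_axis_3_4 by (simp add: \<eta> wedge_real_vec w_def)
qed

lemma P_0_eq: "P_0 = P_alpha \<inter> P_beta"
  by (auto simp: P_0_def P_alpha_def P_beta_def)

lemma gram_form_eq: "gram_form m v = (real_vec v v* m) \<bullet> (real_vec v v* m)"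
  unfolding gram_form_def
  by (simp add: matrix_vector_mul_assoc[symmetric] dot_lmul_matrix[symmetric])

lemma gram_form_sign:
  assumes "e \<in> {1, -1 :: int}"
  shows "gram_form m (e *s v) = gram_form m v"
proof -
  have "real_vec (e *s v) v* m = of_int e *s (real_vec v v* m)"
    by (simp add: vec_eq_iff vector_matrix_mult_def sum_distrib_left mult_ac)
  then show ?thesis
    using assms by (auto simp: gram_form_eq scalar_mult_eq_scaleR)
qed


section \<open>The summands as powers of quadratic forms\<close>

text \<open>Here \<open>A = x\<^sup>-\<^sup>2\<close>; for positive reals the principal branch causes no sign trouble.\<close>

lemma of_real_powr_inverse_square:
  assumes "x > 0" "x\<^sup>2 * A = 1"
  shows "complex_of_real x powr s = complex_of_real A powr (- s / 2)"
proof -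
  have A: "A = 1 / x\<^sup>2"
    using assms by (simp add: field_simps)
  then have "A > 0"
    using assms(1) by simp
  have "ln A = - 2 * ln x"
    using assms(1) by (simp add: A ln_div ln_realpow)
  then show ?thesis
    using assms(1) \<open>A > 0\<close> by (simp add: powr_def Ln_of_real)
qed

lemma iwasawa_y_translate:
  assumes "\<gamma> \<in> Sp4_int" "g \<in> Sp4_real"
  defines "M \<equiv> int_mat \<gamma>" and "y1 \<equiv> fst (iwasawa_y (\<gamma> ** g))" and "y2 \<equiv> snd (iwasawa_y (\<gamma> ** g))"
  shows "y1 > 0" "y2 > 0" "y1\<^sup>2 * gram_form g (M$3) = 1"
    "(y1 * y2)\<^sup>2 * gram_form (ext_square g) (wedge (M$3) (M$4)) = 1"
proof -
  have "\<gamma> ** g \<in> Sp4_real"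
    using assms(1,2) Sp4_real_mult by (simp add: Sp4_int_def)
  note y = iwasawa_y_rows[OF this, folded y1_def y2_def]
  show "y1 > 0" "y2 > 0" by (rule y)+
  show "y1\<^sup>2 * gram_form g (M$3) = 1"
    using y(3) by (simp add: gram_form_eq M_def int_mat_Sp4_int[OF assms(1)] matrix_mult_row)
  show "(y1 * y2)\<^sup>2 * gram_form (ext_square g) (wedge (M$3) (M$4)) = 1"
    using y(4)
    by (simp only: gram_form_eq M_def real_vec_wedge_int_mat[OF assms(1)] matrix_mult_row
        wedge_vector_matrix_mult)
qed

lemma I_beta_translate:
  assumes "\<gamma> \<in> Sp4_int" "g \<in> Sp4_real"
  shows "I_beta \<nu> (\<gamma> ** g) = complex_of_real (gram_form g (int_mat \<gamma> $ 3)) powr (- \<nu>/2 - 1)"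
proof -
  note y = iwasawa_y_translate[OF assms]
  show ?thesis
    unfolding I_beta_def of_real_powr_inverse_square[OF y(1) y(3)] by (simp add: field_simps)
qed

lemma I_alpha_translate:
  assumes "\<gamma> \<in> Sp4_int" "g \<in> Sp4_real"
  shows "I_alpha \<nu> (\<gamma> ** g) =
    complex_of_real (gram_form (ext_square g) (wedge (int_mat \<gamma> $ 3) (int_mat \<gamma> $ 4))) powr (- \<nu>/2 - 3/4)"
proof -
  note y = iwasawa_y_translate[OF assms]
  have "- (\<nu> + 3/2) / 2 = - \<nu>/2 - 3/4"
    by (simp add: field_simps)
  then show ?thesis
    unfolding I_alpha_def of_real_powr_inverse_square[OF mult_pos_pos[OF y(1,2)] y(4)] by (simp only:)
qed

lemma I_0_translate:
  assumes "\<gamma> \<in> Sp4_int" "g \<in> Sp4_real"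
  shows "I_0 \<nu>1 \<nu>2 (\<gamma> ** g) =
    complex_of_real (gram_form g (int_mat \<gamma> $ 3)) powr (\<nu>2 - \<nu>1 - 1/2) *
    complex_of_real (gram_form (ext_square g) (wedge (int_mat \<gamma> $ 3) (int_mat \<gamma> $ 4))) powr (\<nu>1/2 - \<nu>2 - 1/2)"
proof -
  define y1 y2 where "y1 = fst (iwasawa_y (\<gamma> ** g))" and "y2 = snd (iwasawa_y (\<gamma> ** g))"
  note y = iwasawa_y_translate[OF assms, folded y1_def y2_def]
  \<comment> \<open>Regroup into powers of \<open>y\<^sub>1\<close> and \<open>y\<^sub>1 y\<^sub>2\<close>, which are the quantities that the quadratic forms control.\<close>
  have "complex_of_real y1 powr (\<nu>1 + 2) * complex_of_real y2 powr (2 * \<nu>2 - \<nu>1 + 1)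
      = complex_of_real y1 powr (2 * \<nu>1 - 2 * \<nu>2 + 1) * complex_of_real (y1 * y2) powr (2 * \<nu>2 - \<nu>1 + 1)"
    using y(1,2)
    by (simp add: powr_def Ln_of_real ln_mult exp_add[symmetric] algebra_simps flip: of_real_mult)
  also have "\<dots> = complex_of_real (gram_form g (int_mat \<gamma> $ 3)) powr (- (2 * \<nu>1 - 2 * \<nu>2 + 1) / 2) *
      complex_of_real (gram_form (ext_square g) (wedge (int_mat \<gamma> $ 3) (int_mat \<gamma> $ 4)))
        powr (- (2 * \<nu>2 - \<nu>1 + 1) / 2)"
    by (simp only: of_real_powr_inverse_square[OF y(1) y(3)]
        of_real_powr_inverse_square[OF mult_pos_pos[OF y(1,2)] y(4)])
  also have "- (2 * \<nu>1 - 2 * \<nu>2 + 1) / 2 = \<nu>2 - \<nu>1 - 1/2"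
    by (simp add: field_simps)
  also have "- (2 * \<nu>2 - \<nu>1 + 1) / 2 = \<nu>1/2 - \<nu>2 - 1/2"
    by (simp add: field_simps)
  finally show ?thesis
    by (simp add: I_0_def y1_def y2_def)
qed


section \<open>From cosets to signed orbits\<close>

text \<open>The map \<open>\<Phi>\<close> induces a bijection from the cosets of \<open>H\<close> to the orbits of a finite set of signs \<open>E\<close> on \<open>X\<close>.
The signs act freely, so each orbit has \<open>card E\<close> points. The hypothesis on \<open>H\<close> says that \<open>H\<close> preserves
every value of \<open>\<Phi>\<close> up to sign and contains all elements that preserve one of them; this already makes \<open>H\<close>
a subgroup. The cancellation law makes "equal up to sign" an equivalence relation.\<close>

lemma sum_over_signed_cosets:
  fixes G (structure) and \<Phi> :: "'g \<Rightarrow> 'x" and act :: "'e \<Rightarrow> 'x \<Rightarrow> 'x" and f :: "'x \<Rightarrow> complex"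
  assumes "group G" and HG: "H \<subseteq> carrier G" and finE: "finite E"
    and same: "\<And>\<eta> \<delta>. \<eta> \<in> carrier G \<Longrightarrow> \<delta> \<in> carrier G \<Longrightarrow>
      \<eta> \<in> H \<longleftrightarrow> (\<exists>e\<in>E. \<Phi> (\<eta> \<otimes> \<delta>) = act e (\<Phi> \<delta>))"
    and inX: "\<And>\<gamma>. \<gamma> \<in> carrier G \<Longrightarrow> \<Phi> \<gamma> \<in> X"
    and actX: "\<And>e x. e \<in> E \<Longrightarrow> x \<in> X \<Longrightarrow> act e x \<in> X"
    and surj: "\<And>x. x \<in> X \<Longrightarrow> \<exists>\<gamma>\<in>carrier G. \<Phi> \<gamma> = x"
    and free: "\<And>e e' x. e \<in> E \<Longrightarrow> e' \<in> E \<Longrightarrow> x \<in> X \<Longrightarrow> act e x = act e' x \<Longrightarrow> e = e'"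
    and cancel: "\<And>e e' x y. e \<in> E \<Longrightarrow> e' \<in> E \<Longrightarrow> act e x = act e' y \<Longrightarrow> \<exists>e''\<in>E. x = act e'' y"
    and E_ne: "E \<noteq> {}"
    and f_act: "\<And>e x. e \<in> E \<Longrightarrow> x \<in> X \<Longrightarrow> f (act e x) = f x"
    and F: "\<And>\<gamma>. \<gamma> \<in> carrier G \<Longrightarrow> F \<gamma> = f (\<Phi> \<gamma>)"
  defines "T \<equiv> \<lambda>C. F (SOME \<gamma>. \<gamma> \<in> C)"
  assumes summ: "(\<lambda>C. norm (T C)) summable_on rcosets H"
  shows "(\<lambda>x. norm (f x)) summable_on X \<and> infsum f X = of_nat (card E) * infsum T (rcosets H)"
proof -
  interpret group G by fact
  let ?rep = "\<lambda>C. SOME \<gamma>. \<gamma> \<in> C" and ?R = "\<lambda>x y. \<exists>e\<in>E. x = act e y"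
  have R_refl: "?R x x" for x
    using E_ne cancel by blast
  have R_sym: "?R y x" if xy: "?R x y" for x y
  proof -
    obtain e e0 where "e \<in> E" "x = act e y" "e0 \<in> E" "x = act e0 x"
      using xy R_refl by metis
    then show ?thesis
      using cancel[of e e0 y x] by metis
  qed
  have R_trans: "?R x z" if xy: "?R x y" and yz: "?R y z" for x y z
  proof -
    obtain e e' where "e \<in> E" "y = act e x" "e' \<in> E" "y = act e' z"
      using R_sym[OF xy] yz by blast
    then show ?thesis
      using cancel[of e e' x z] by metis
  qed
  have H_iff: "\<gamma> \<otimes> inv \<delta> \<in> H \<longleftrightarrow> ?R (\<Phi> \<gamma>) (\<Phi> \<delta>)" if "\<gamma> \<in> carrier G" "\<delta> \<in> carrier G" for \<gamma> \<delta>
    using same[of "\<gamma> \<otimes> inv \<delta>" \<delta>] that by (simp add: m_assoc)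
  have H_one: "\<gamma> \<in> H \<longleftrightarrow> ?R (\<Phi> \<gamma>) (\<Phi> \<one>)" if "\<gamma> \<in> carrier G" for \<gamma>
    using H_iff[OF that one_closed] that by simp
  have "subgroup H G"
  proof (rule subgroupI)
    show "H \<subseteq> carrier G" by fact
    show "H \<noteq> {}"
      using H_one[OF one_closed] R_refl by blast
    show "inv a \<in> H" if "a \<in> H" for a
    proof -
      have a: "a \<in> carrier G" using that HG by blast
      then have "?R (\<Phi> \<one>) (\<Phi> a)"
        using that H_one R_sym by blast
      then show ?thesis
        using H_iff[OF one_closed a] a by simp
    qed
    show "a \<otimes> b \<in> H" if "a \<in> H" "b \<in> H" for a b
    proof -
      have ab: "a \<in> carrier G" "b \<in> carrier G" using that HG by blast+
      have "?R (\<Phi> (a \<otimes> b)) (\<Phi> b)" using same ab that by blast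
      moreover have "?R (\<Phi> b) (\<Phi> \<one>)" using H_one ab that by blast
      ultimately show ?thesis
        using H_one[of "a \<otimes> b"] R_trans ab m_closed by blast
    qed
  qed
  then interpret H: subgroup H G .
  have rep: "?rep C \<in> C" "?rep C \<in> carrier G" "C = H #> ?rep C" if C: "C \<in> rcosets H" for C
  proof -
    obtain a where a: "a \<in> carrier G" "C = H #> a"
      using C unfolding RCOSETS_def by blast
    then have "a \<in> C"
      using rcos_self \<open>subgroup H G\<close> by blast
    then show 1: "?rep C \<in> C"
      by (rule someI)
    then show "?rep C \<in> carrier G"
      using H.rcosets_carrier[OF group_axioms C] by blast
    show "C = H #> ?rep C"
      using repr_independence[of "?rep C" H a] 1 a \<open>subgroup H G\<close> by simp
  qed
  have coset_eq: "H #> \<gamma> = H #> \<delta> \<longleftrightarrow> ?R (\<Phi> \<gamma>) (\<Phi> \<delta>)" if "\<gamma> \<in> carrier G" "\<delta> \<in> carrier G" for \<gamma> \<delta>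
    using H_iff[OF that] H.rcos_module[OF group_axioms that(2,1)] that
      repr_independence[of \<gamma> H \<delta>] repr_independenceD[of H \<gamma> \<delta>] \<open>subgroup H G\<close>
    by (metis rcos_self)
  \<comment> \<open>A point of \<open>X\<close> is a coset, through the value of \<open>\<Phi>\<close> at the chosen representative, together with a sign.\<close>
  have bij: "bij_betw (\<lambda>(C, e). act e (\<Phi> (?rep C))) ((rcosets H) \<times> E) X"
    unfolding bij_betw_def
  proof
    show "inj_on (\<lambda>(C, e). act e (\<Phi> (?rep C))) ((rcosets H) \<times> E)"
    proof (rule inj_onI, clarify)
      fix C e D e'
      assume C: "C \<in> rcosets H" and D: "D \<in> rcosets H" and e: "e \<in> E" "e' \<in> E"
        and eq: "act e (\<Phi> (?rep C)) = act e' (\<Phi> (?rep D))"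
      have "H #> ?rep C = H #> ?rep D"
        using coset_eq[OF rep(2)[OF C] rep(2)[OF D]] cancel[OF e eq] by blast
      then have "C = D"
        using rep(3)[OF C] rep(3)[OF D] by simp
      then show "C = D \<and> e = e'"
        using free[OF e inX[OF rep(2)[OF C]]] eq by simp
    qed
    show "(\<lambda>(C, e). act e (\<Phi> (?rep C))) ` ((rcosets H) \<times> E) = X"
    proof (intro equalityI subsetI)
      fix x assume "x \<in> (\<lambda>(C, e). act e (\<Phi> (?rep C))) ` ((rcosets H) \<times> E)"
      then show "x \<in> X"
        using actX inX rep(2) by auto
    next
      fix x assume "x \<in> X"
      then obtain \<gamma> where \<gamma>: "\<gamma> \<in> carrier G" "\<Phi> \<gamma> = x"
        using surj by blast
      let ?C = "H #> \<gamma>"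
      have C: "?C \<in> rcosets H"
        using rcosetsI HG \<gamma>(1) by blast
      obtain e where "e \<in> E" "x = act e (\<Phi> (?rep ?C))"
        using coset_eq[OF \<gamma>(1) rep(2)[OF C]] rep(3)[OF C] \<gamma>(2) by blast
      then show "x \<in> (\<lambda>(C, e). act e (\<Phi> (?rep C))) ` ((rcosets H) \<times> E)"
        using C by force
    qed
  qed
  have val: "f (act e (\<Phi> (?rep C))) = T C" if "C \<in> rcosets H" "e \<in> E" for C e
    using F f_act inX rep(2) that by (simp add: T_def)
  have "(\<lambda>p. norm (case p of (C, e) \<Rightarrow> T C)) summable_on ((rcosets H) \<times> E)"
    by (rule Infinite_Sum.abs_summable_on_Sigma_iff[THEN iffD2])
       (use finE summable_on_cmult_right[OF summ, of "of_nat (card E)"] in \<open>simp add: norm_mult\<close>)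
  then have abs: "(\<lambda>p. norm (f ((\<lambda>(C, e). act e (\<Phi> (?rep C))) p))) summable_on ((rcosets H) \<times> E)"
    by (rule summable_on_cong[THEN iffD1, rotated]) (auto simp: val)
  then have summable: "(\<lambda>x. norm (f x)) summable_on X"
    using summable_on_reindex_bij_betw[OF bij, of "\<lambda>x. norm (f x)"] by simp
  have "infsum f X = infsum (\<lambda>p. f ((\<lambda>(C, e). act e (\<Phi> (?rep C))) p)) ((rcosets H) \<times> E)"
    by (rule infsum_reindex_bij_betw[OF bij, symmetric])
  also have "\<dots> = (\<Sum>\<^sub>\<infinity>C\<in>rcosets H. \<Sum>\<^sub>\<infinity>e\<in>E. f (act e (\<Phi> (?rep C))))"
    using infsum_Sigma'_banach[of "\<lambda>C e. f (act e (\<Phi> (?rep C)))" "rcosets H" "\<lambda>_. E"]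
      Infinite_Sum.abs_summable_summable[OF abs] by (simp add: case_prod_unfold)
  also have "\<dots> = (\<Sum>\<^sub>\<infinity>C\<in>rcosets H. of_nat (card E) * T C)"
    by (rule infsum_cong) (simp add: finE val)
  also have "\<dots> = of_nat (card E) * infsum T (rcosets H)"
    by (rule infsum_cmult_right')
  finally show ?thesis
    using summable by blast
qed


section \<open>The three identities\<close>

lemma sign_cancel:
  fixes x y :: "int^'n"
  assumes "e \<in> {1, -1}" "e' \<in> {1, -1 :: int}" "e *s x = e' *s y"
  shows "x = (e * e') *s y" "e * e' \<in> {1, -1}"
proof -
  have "x = (e * e) *s x"
    using assms(1) by auto
  also have "\<dots> = (e * e') *s y"
    by (simp only: vector_smult_assoc[symmetric] assms(3))
  finally show "x = (e * e') *s y" .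
qed (use assms in auto)

lemma sign_free:
  assumes "primitive_vec v" "e *s v = e' *s v"
  shows "e = e'"
proof -
  have "\<not> (\<forall>i. 0 dvd v$i)"
    using assms(1) not_is_unit_0 unfolding primitive_vec_iff by blast
  then obtain i where "v$i \<noteq> 0"
    by auto
  moreover have "e * v$i = e' * v$i"
    using assms(2) by (metis vector_smult_component)
  ultimately show ?thesis
    by simp
qed

lemma primitive_vec_sign:
  assumes "e \<in> {1, -1 :: int}"
  shows "primitive_vec (e *s v) \<longleftrightarrow> primitive_vec v"
  using assms by (auto simp: primitive_vec_iff)

lemma carrier_Sp4_int_group:
  "carrier Sp4_int_group = Sp4_int" "mult Sp4_int_group = (**)"
  by (simp_all add: Sp4_int_group_def)

lemma eisenstein_term_eq: "eisenstein_term I g = (\<lambda>C. (\<lambda>\<gamma>. I (\<gamma> ** g)) (SOME \<gamma>. \<gamma> \<in> C))"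
  by (simp add: eisenstein_term_def fun_eq_iff)

lemma real_vec_scale: "real_vec (e *s v) = of_int e *s real_vec v"
  by (simp add: vec_eq_iff)

lemma Sp4_int_mult: "\<eta> \<in> Sp4_int \<Longrightarrow> \<delta> \<in> Sp4_int \<Longrightarrow> \<eta> ** \<delta> \<in> Sp4_int"
  using group.is_monoid[OF Sp4_int_group, THEN monoid.m_closed, of \<eta> \<delta>]
  by (simp add: carrier_Sp4_int_group)

lemma int_row_mult_iff:
  assumes "\<eta> \<in> Sp4_int" "\<delta> \<in> Sp4_int"
  shows "int_mat (\<eta> ** \<delta>) $ 3 = e *s int_mat \<delta> $ 3 \<longleftrightarrow> \<eta>$3 = of_int e *s axis 3 1"
proof -
  have inv: "invertible \<delta>"
    using assms(2) by (simp add: Sp4_int_def Sp4_real_def)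
  show ?thesis
    unfolding real_vec_eq_iff[symmetric] real_vec_scale int_mat_Sp4_int(2)[OF assms(2)]
      int_mat_Sp4_int(2)[OF Sp4_int_mult[OF assms]]
    by (rule row_mult_eq_iff[OF inv])
qed

lemma int_wedge_mult_iff:
  assumes "\<eta> \<in> Sp4_int" "\<delta> \<in> Sp4_int"
  shows "wedge (int_mat (\<eta> ** \<delta>) $ 3) (int_mat (\<eta> ** \<delta>) $ 4) = e *s wedge (int_mat \<delta> $ 3) (int_mat \<delta> $ 4)
    \<longleftrightarrow> wedge (\<eta>$3) (\<eta>$4) = of_int e *s wedge (axis 3 1) (axis 4 1)"
proof -
  have inv: "invertible \<delta>"
    using assms(2) by (simp add: Sp4_int_def Sp4_real_def)
  show ?thesis
    unfolding real_vec_eq_iff[symmetric] real_vec_scale real_vec_wedge_int_mat[OF assms(2)]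
      real_vec_wedge_int_mat[OF Sp4_int_mult[OF assms]]
    by (rule wedge_mult_eq_iff[OF inv])
qed

lemma eisenstein_sum_over_signed_orbit:
  fixes \<Phi> :: "real^4^4 \<Rightarrow> 'x" and act :: "'e \<Rightarrow> 'x \<Rightarrow> 'x" and f :: "'x \<Rightarrow> complex"
  assumes conv: "eisenstein_abs_conv P I g" and finE: "finite E" "E \<noteq> {}"
    and same: "\<And>\<eta> \<delta>. \<eta> \<in> Sp4_int \<Longrightarrow> \<delta> \<in> Sp4_int \<Longrightarrow>
      \<eta> \<in> P \<longleftrightarrow> (\<exists>e\<in>E. \<Phi> (\<eta> ** \<delta>) = act e (\<Phi> \<delta>))"
    and image: "\<Phi> ` Sp4_int = X"
    and actX: "\<And>e x. e \<in> E \<Longrightarrow> x \<in> X \<Longrightarrow> act e x \<in> X"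
    and free: "\<And>e e' x. e \<in> E \<Longrightarrow> e' \<in> E \<Longrightarrow> x \<in> X \<Longrightarrow> act e x = act e' x \<Longrightarrow> e = e'"
    and cancel: "\<And>e e' x y. e \<in> E \<Longrightarrow> e' \<in> E \<Longrightarrow> act e x = act e' y \<Longrightarrow> \<exists>e''\<in>E. x = act e'' y"
    and f_act: "\<And>e x. e \<in> E \<Longrightarrow> x \<in> X \<Longrightarrow> f (act e x) = f x"
    and I: "\<And>\<gamma>. \<gamma> \<in> Sp4_int \<Longrightarrow> I (\<gamma> ** g) = f (\<Phi> \<gamma>)"
  shows "(\<lambda>x. norm (f x)) summable_on X \<and>
    infsum f X = of_nat (card E) * infsum (eisenstein_term I g) (parabolic_cosets P)"
  unfolding eisenstein_term_eq parabolic_cosets_def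
proof (rule sum_over_signed_cosets[where \<Phi> = \<Phi> and act = act, OF Sp4_int_group _ finE(1)])
  show "(\<lambda>C. norm (I ((SOME \<gamma>. \<gamma> \<in> C) ** g))) summable_on rcosets\<^bsub>Sp4_int_group\<^esub> (P \<inter> Sp4_int)"
    using conv by (simp add: eisenstein_abs_conv_def eisenstein_term_def parabolic_cosets_def)
  show "\<exists>\<gamma>\<in>carrier Sp4_int_group. \<Phi> \<gamma> = x" if "x \<in> X" for x
    using that image by (auto simp: carrier_Sp4_int_group)
  show "(\<eta> \<in> P \<inter> Sp4_int) = (\<exists>e\<in>E. \<Phi> (\<eta> \<otimes>\<^bsub>Sp4_int_group\<^esub> \<delta>) = act e (\<Phi> \<delta>))"
    if "\<eta> \<in> carrier Sp4_int_group" "\<delta> \<in> carrier Sp4_int_group" for \<eta> \<delta>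
    using that same[of \<eta> \<delta>] by (simp add: carrier_Sp4_int_group)
  show "\<Phi> \<gamma> \<in> X" if "\<gamma> \<in> carrier Sp4_int_group" for \<gamma>
    using that image by (auto simp: carrier_Sp4_int_group)
qed (use finE actX free cancel f_act I in \<open>auto simp: carrier_Sp4_int_group\<close>)

lemma image_row3: "(\<lambda>\<gamma>. int_mat \<gamma> $ 3) ` Sp4_int = V_beta_prim"
proof (intro equalityI subsetI)
  fix v assume "v \<in> (\<lambda>\<gamma>. int_mat \<gamma> $ 3) ` Sp4_int"
  then show "v \<in> V_beta_prim"
    using symplectic_flag_V_0_prim by (auto simp: Sp4_int_eq V_beta_prim_iff V_0_prim_iff)
next
  fix v assume "v \<in> V_beta_prim"
  then show "v \<in> (\<lambda>\<gamma>. int_mat \<gamma> $ 3) ` Sp4_int"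
    using symplectic_frame_row3_exists[of v] by (force simp: V_beta_prim_iff Sp4_int_eq)
qed

lemma image_flag:
  "(\<lambda>\<gamma>. (int_mat \<gamma> $ 3, wedge (int_mat \<gamma> $ 3) (int_mat \<gamma> $ 4))) ` Sp4_int = V_0_prim"
proof (intro equalityI subsetI)
  fix x assume "x \<in> (\<lambda>\<gamma>. (int_mat \<gamma> $ 3, wedge (int_mat \<gamma> $ 3) (int_mat \<gamma> $ 4))) ` Sp4_int"
  then show "x \<in> V_0_prim"
    using symplectic_flag_V_0_prim by (auto simp: Sp4_int_eq)
next
  fix x assume "x \<in> V_0_prim"
  then show "x \<in> (\<lambda>\<gamma>. (int_mat \<gamma> $ 3, wedge (int_mat \<gamma> $ 3) (int_mat \<gamma> $ 4))) ` Sp4_int"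
    using symplectic_flag_exists[of "fst x" "snd x"] by (force simp: Sp4_int_eq)
qed

text \<open>Every primitive isotropic bivector extends to a primitive flag, so surjectivity onto flags implies
surjectivity onto planes.\<close>

lemma image_plane:
  "(\<lambda>\<gamma>. wedge (int_mat \<gamma> $ 3) (int_mat \<gamma> $ 4)) ` Sp4_int = V_alpha_prim"
proof (intro equalityI subsetI)
  fix w assume "w \<in> (\<lambda>\<gamma>. wedge (int_mat \<gamma> $ 3) (int_mat \<gamma> $ 4)) ` Sp4_int"
  then show "w \<in> V_alpha_prim"
    using symplectic_flag_V_alpha_prim by (auto simp: Sp4_int_eq)
next
  fix w assume "w \<in> V_alpha_prim"
  then obtain v where "(v, w) \<in> V_0_prim"
    using V_alpha_prim_incident_exists by blast
  then show "w \<in> (\<lambda>\<gamma>. wedge (int_mat \<gamma> $ 3) (int_mat \<gamma> $ 4)) ` Sp4_int"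
    unfolding image_flag[symmetric] by blast
qed

lemma incident_scale: "incident v w \<Longrightarrow> incident (c *s v) (d *s w)"
proof -
  assume "incident v w"
  then have "(c * d) * (v$1 * w$4 - v$2 * w$2 + v$3 * w$1) = 0" "(c * d) * (v$1 * w$5 - v$2 * w$3 + v$4 * w$1) = 0"
     "(c * d) * (v$1 * w$6 - v$3 * w$3 + v$4 * w$2) = 0" "(c * d) * (v$2 * w$6 - v$3 * w$5 + v$4 * w$4) = 0"
    by (simp_all add: incident_def)
  then show ?thesis
    by (simp add: incident_def algebra_simps)
qed

lemma V_0_prim_sign:
  assumes "(v, w) \<in> V_0_prim" "e \<in> {1, -1}" "e' \<in> {1, -1 :: int}"
  shows "(e *s v, e' *s w) \<in> V_0_prim"
proof -
  have "e' * (w$2 + w$5) = 0"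
    using assms(1) by (simp add: V_0_prim_iff)
  then show ?thesis
    using assms incident_scale
    by (simp add: V_0_prim_iff primitive_vec_sign[OF assms(2)] primitive_vec_sign[OF assms(3)] distrib_left)
qed

lemma V_alpha_prim_sign:
  assumes "w \<in> V_alpha_prim" "e \<in> {1, -1 :: int}"
  shows "e *s w \<in> V_alpha_prim"
  using V_0_prim_sign[OF _ assms(2) assms(2)] V_alpha_prim_incident_exists[OF assms(1)]
    assms by (auto simp: V_alpha_prim_iff V_0_prim_iff)

lemma E_beta_identity:
  fixes \<nu> :: complex
  assumes g: "g \<in> Sp4_real" and conv: "eisenstein_abs_conv P_beta (I_beta \<nu>) g"
  defines "f \<equiv> \<lambda>v. complex_of_real (gram_form g v) powr (- \<nu>/2 - 1)"
  shows "(\<lambda>v. norm (f v)) summable_on V_beta_prim \<and> E_beta g \<nu> = 1/2 * infsum f V_beta_prim"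
proof -
  have "(\<lambda>v. norm (f v)) summable_on V_beta_prim
      \<and> infsum f V_beta_prim = of_nat (card {1, -1 :: int}) * E_beta g \<nu>"
    unfolding E_beta_def
  proof (rule eisenstein_sum_over_signed_orbit[OF conv, where act = "(*s)", OF _ _ _ image_row3])
    show "\<eta> \<in> P_beta \<longleftrightarrow> (\<exists>e\<in>{1, -1 :: int}. int_mat (\<eta> ** \<delta>) $ 3 = e *s int_mat \<delta> $ 3)"
      if "\<eta> \<in> Sp4_int" "\<delta> \<in> Sp4_int" for \<eta> \<delta>
      using that by (simp only: int_row_mult_iff P_beta_iff)
    show "e *s v \<in> V_beta_prim" if "e \<in> {1, -1}" "v \<in> V_beta_prim" for e v
      using that by (simp only: V_beta_prim_iff primitive_vec_sign)
    show "e = e'" if "e \<in> {1, -1}" "e' \<in> {1, -1}" "v \<in> V_beta_prim" "e *s v = e' *s v" for e e' v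
      using that sign_free V_beta_prim_iff by blast
    show "\<exists>e''\<in>{1, -1}. x = e'' *s y" if "e \<in> {1, -1}" "e' \<in> {1, -1}" "e *s x = e' *s y"
      for e e' and x y :: "int^4"
      using sign_cancel[OF that] by blast
    show "f (e *s v) = f v" if "e \<in> {1, -1}" for e v
      by (simp only: f_def gram_form_sign[OF that])
    show "I_beta \<nu> (\<gamma> ** g) = f (int_mat \<gamma> $ 3)" if "\<gamma> \<in> Sp4_int" for \<gamma>
      by (simp only: f_def I_beta_translate[OF that g])
  qed simp_all
  then show ?thesis
    by simp
qed

lemma E_alpha_identity:
  fixes \<nu> :: complex
  assumes g: "g \<in> Sp4_real" and conv: "eisenstein_abs_conv P_alpha (I_alpha \<nu>) g"
  defines "f \<equiv> \<lambda>w. complex_of_real (gram_form (ext_square g) w) powr (- \<nu>/2 - 3/4)"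
  shows "(\<lambda>w. norm (f w)) summable_on V_alpha_prim \<and> E_alpha g \<nu> = 1/2 * infsum f V_alpha_prim"
proof -
  have "(\<lambda>w. norm (f w)) summable_on V_alpha_prim
      \<and> infsum f V_alpha_prim = of_nat (card {1, -1 :: int}) * E_alpha g \<nu>"
    unfolding E_alpha_def
  proof (rule eisenstein_sum_over_signed_orbit[OF conv, where act = "(*s)", OF _ _ _ image_plane])
    show "\<eta> \<in> P_alpha \<longleftrightarrow> (\<exists>e\<in>{1, -1 :: int}. wedge (int_mat (\<eta> ** \<delta>) $ 3) (int_mat (\<eta> ** \<delta>) $ 4)
        = e *s wedge (int_mat \<delta> $ 3) (int_mat \<delta> $ 4))"
      if "\<eta> \<in> Sp4_int" "\<delta> \<in> Sp4_int" for \<eta> \<delta>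
      using that by (simp only: int_wedge_mult_iff P_alpha_iff)
    show "e *s w \<in> V_alpha_prim" if "e \<in> {1, -1}" "w \<in> V_alpha_prim" for e w
      using that V_alpha_prim_sign by blast
    show "e = e'" if "e \<in> {1, -1}" "e' \<in> {1, -1}" "w \<in> V_alpha_prim" "e *s w = e' *s w" for e e' w
      using that sign_free V_alpha_prim_iff by blast
    show "\<exists>e''\<in>{1, -1}. x = e'' *s y" if "e \<in> {1, -1}" "e' \<in> {1, -1}" "e *s x = e' *s y"
      for e e' and x y :: "int^6"
      using sign_cancel[OF that] by blast
    show "f (e *s w) = f w" if "e \<in> {1, -1}" for e w
      by (simp only: f_def gram_form_sign[OF that])
    show "I_alpha \<nu> (\<gamma> ** g) = f (wedge (int_mat \<gamma> $ 3) (int_mat \<gamma> $ 4))" if "\<gamma> \<in> Sp4_int" for \<gamma>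
      by (simp only: f_def I_alpha_translate[OF that g])
  qed simp_all
  then show ?thesis
    by simp
qed

lemma bex_Times_conj:
  "(\<exists>p\<in>A \<times> B. R (fst p) \<and> S (snd p)) \<longleftrightarrow> (\<exists>a\<in>A. R a) \<and> (\<exists>b\<in>B. S b)"
  by force

lemma E_0_identity:
  fixes \<nu>1 \<nu>2 :: complex
  assumes g: "g \<in> Sp4_real" and conv: "eisenstein_abs_conv P_0 (I_0 \<nu>1 \<nu>2) g"
  defines "f \<equiv> \<lambda>(v, w). complex_of_real (gram_form g v) powr (\<nu>2 - \<nu>1 - 1/2) *
      complex_of_real (gram_form (ext_square g) w) powr (\<nu>1/2 - \<nu>2 - 1/2)"
  shows "(\<lambda>x. norm (f x)) summable_on V_0_prim \<and> E_0 g \<nu>1 \<nu>2 = 1/4 * infsum f V_0_prim"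
proof -
  let ?E = "{1, -1 :: int} \<times> {1, -1 :: int}"
  let ?act = "\<lambda>(e :: int \<times> int) (x :: (int^4) \<times> (int^6)). (fst e *s fst x, snd e *s snd x)"
  have "(\<lambda>x. norm (f x)) summable_on V_0_prim
      \<and> infsum f V_0_prim = of_nat (card ?E) * E_0 g \<nu>1 \<nu>2"
    unfolding E_0_def
  proof (rule eisenstein_sum_over_signed_orbit[OF conv, where act = ?act, OF _ _ _ image_flag])
    show "\<eta> \<in> P_0 \<longleftrightarrow> (\<exists>e\<in>?E. (int_mat (\<eta> ** \<delta>) $ 3, wedge (int_mat (\<eta> ** \<delta>) $ 3) (int_mat (\<eta> ** \<delta>) $ 4))
        = ?act e (int_mat \<delta> $ 3, wedge (int_mat \<delta> $ 3) (int_mat \<delta> $ 4)))"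
      if "\<eta> \<in> Sp4_int" "\<delta> \<in> Sp4_int" for \<eta> \<delta>
    proof -
      have "\<eta> \<in> P_0 \<longleftrightarrow> (\<exists>e\<in>{1, -1}. int_mat (\<eta> ** \<delta>) $ 3 = e *s int_mat \<delta> $ 3) \<and>
          (\<exists>e\<in>{1, -1}. wedge (int_mat (\<eta> ** \<delta>) $ 3) (int_mat (\<eta> ** \<delta>) $ 4)
            = e *s wedge (int_mat \<delta> $ 3) (int_mat \<delta> $ 4))"
        unfolding int_row_mult_iff[OF that] int_wedge_mult_iff[OF that]
          P_beta_iff[OF that(1), symmetric] P_alpha_iff[OF that(1), symmetric] P_0_eq by blast
      then show ?thesis
        unfolding bex_Times_conj[symmetric] by (simp only: fst_conv snd_conv prod.inject)
    qed
    show "?act e x \<in> V_0_prim" if "e \<in> ?E" "x \<in> V_0_prim" for e x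
      using that V_0_prim_sign[of "fst x" "snd x" "fst e" "snd e"]
      by (simp only: mem_Times_iff prod.collapse)
    show "e = e'" if "x \<in> V_0_prim" "?act e x = ?act e' x" for e e' x
    proof -
      have "primitive_vec (fst x)" "primitive_vec (snd x)"
        using that(1) V_0_prim_iff[of "fst x" "snd x"] by simp_all
      then show ?thesis
        using that(2) by (intro prod_eqI) (auto dest: sign_free)
    qed
    show "\<exists>e''\<in>?E. x = ?act e'' y" if "e \<in> ?E" "e' \<in> ?E" "?act e x = ?act e' y" for e e' x y
    proof
      have "fst e *s fst x = fst e' *s fst y" "snd e *s snd x = snd e' *s snd y"
        "fst e \<in> {1, -1}" "fst e' \<in> {1, -1}" "snd e \<in> {1, -1}" "snd e' \<in> {1, -1}"
        using that by (simp_all only: mem_Times_iff prod.inject)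
      note cancel = sign_cancel[OF this(3,4,1)] sign_cancel[OF this(5,6,2)]
      show "(fst e * fst e', snd e * snd e') \<in> ?E"
        using cancel(2,4) by (simp only: mem_Times_iff fst_conv snd_conv simp_thms)
      show "x = ?act (fst e * fst e', snd e * snd e') y"
        by (rule prod_eqI) (simp_all only: fst_conv snd_conv cancel(1,3)[symmetric])
    qed
    show "f (?act e x) = f x" if "e \<in> ?E" for e x
    proof -
      have "fst e \<in> {1, -1}" "snd e \<in> {1, -1}"
        using that by (simp_all only: mem_Times_iff)
      then show ?thesis
        by (simp only: f_def case_prod_beta fst_conv snd_conv gram_form_sign)
    qed
    show "I_0 \<nu>1 \<nu>2 (\<gamma> ** g) = f (int_mat \<gamma> $ 3, wedge (int_mat \<gamma> $ 3) (int_mat \<gamma> $ 4))"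
      if "\<gamma> \<in> Sp4_int" for \<gamma>
      by (simp only: f_def prod.case I_0_translate[OF that g])
  qed simp_all
  then show ?thesis
    by simp
qed

theorem theorem3p3:
  fixes g :: "real^4^4"
  assumes "g \<in> Sp4_real"
  shows
    "(\<forall>\<nu>1 \<nu>2 :: complex. eisenstein_abs_conv P_0 (I_0 \<nu>1 \<nu>2) g \<longrightarrow>
        (let f = (\<lambda>(v, w).
               complex_of_real (gram_form g v) powr (\<nu>2 - \<nu>1 - 1/2) *
               complex_of_real (gram_form (ext_square g) w) powr (\<nu>1/2 - \<nu>2 - 1/2))
         in (\<lambda>v. norm (f v)) summable_on V_0_prim \<and> E_0 g \<nu>1 \<nu>2 = 1/4 * infsum f V_0_prim)) \<and>
     (\<forall>\<nu> :: complex. eisenstein_abs_conv P_alpha (I_alpha \<nu>) g \<longrightarrow>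
        (let f = (\<lambda>w. complex_of_real (gram_form (ext_square g) w) powr (- \<nu>/2 - 3/4))
         in (\<lambda>v. norm (f v)) summable_on V_alpha_prim \<and> E_alpha g \<nu> = 1/2 * infsum f V_alpha_prim)) \<and>
     (\<forall>\<nu> :: complex. eisenstein_abs_conv P_beta (I_beta \<nu>) g \<longrightarrow>
        (let f = (\<lambda>v. complex_of_real (gram_form g v) powr (- \<nu>/2 - 1))
         in (\<lambda>v. norm (f v)) summable_on V_beta_prim \<and> E_beta g \<nu> = 1/2 * infsum f V_beta_prim))"
  unfolding Let_def using E_0_identity[OF assms] E_alpha_identity[OF assms] E_beta_identity[OF assms] by blast
end
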